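(* Let $\lambda<\kappa$ be infinite regular cardinals and assume that $\square(\kappa)$ holds. Given a stationary subset $S$ of $\kappa$, there is a $\square^{\mathrm{ind}}(\kappa,\lambda)$-sequence $$\vec{\mathcal{C}}=\langle C_{\alpha,i}\mid\alpha\in\mathrm{acc}(\kappa),\ i(\alpha)\leq i<\lambda\rangle$$ with the following properties: (1) If $i<\lambda$, then the set $\{\alpha\in S\cap\mathrm{acc}(\kappa)\mid i(\alpha)=i\}$ is stationary in $\kappa$. (2) There is a $\square(\kappa)$-sequence $\langle D_\alpha\mid\alpha<\kappa\rangle$ such that $\mathrm{acc}(D_\alpha)\subseteq\mathrm{acc}(C_{\alpha,i(\alpha)})$ holds for all $\alpha\in\mathrm{acc}(\kappa)$.
   Context: For a set $A$ of ordinals, $\mathrm{acc}(A)$ is the set of $\alpha\in A$ with $\alpha>0$ and $\sup(A\cap\alpha)=\alpha$; so $\mathrm{acc}(\kappa)$ is the set of nonzero limit ordinals below $\kappa$. A $\square(\kappa)$-sequence is a sequence $\langle D_\alpha\mid\alpha<\kappa\rangle$ such that (a) for all $\alpha\in\mathrm{acc}(\kappa)$, $D_\alpha$ is a club subset of $\alpha$; (b) if $\alpha,\beta\in\mathrm{acc}(\kappa)$ and $\alpha\in\mathrm{acc}(D_\beta)$, then $D_\alpha=D_\beta\cap\alpha$; (c) there is no club $D$ in $\kappa$ such that $D\cap\alpha=D_\alpha$ for all $\alpha\in\mathrm{acc}(D)$. (Entries at non-limit indices are irrelevant.) $\square(\kappa)$ asserts that such a sequence exists. A $\square^{\mathrm{ind}}(\kappa,\lambda)$-sequence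 is a matrix $\langle C_{\alpha,i}\mid\alpha<\kappa,\ i(\alpha)\leq i<\lambda\rangle$ (only entries with $\alpha\in\mathrm{acc}(\kappa)$ are relevant) such that: (1) If $\alpha\in\mathrm{acc}(\kappa)$, then $i(\alpha)<\lambda$. (2) If $\alpha\in\mathrm{acc}(\kappa)$ and $i(\alpha)\leq i<\lambda$, then $C_{\alpha,i}$ is a club subset of $\alpha$. (3) If $\alpha\in\mathrm{acc}(\kappa)$ and $i(\alpha)\leq i<j<\lambda$, then $C_{\alpha,i}\subseteq C_{\alpha,j}$. (4) If $\alpha,\beta\in\mathrm{acc}(\kappa)$ and $i(\beta)\leq i<\lambda$, then $\alpha\in\mathrm{acc}(C_{\beta,i})$ implies that $i\geq i(\alpha)$ and $C_{\alpha,i}=C_{\beta,i}\cap\alpha$. (5) If $\alpha,\beta\in\mathrm{acc}(\kappa)$ with $\alpha<\beta$, then there is $i(\beta)\leq i<\lambda$ with $\alpha\in\mathrm{acc}(C_{\beta,i})$. (6) There is no club subset $D$ of $\kappa$ such that for all $\alpha\in\mathrm{acc}(D)$ there is $i<\lambda$ (with $i\geq i(\alpha)$) such that $C_{\alpha,i}=D\cap\alpha$. *)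

theory Defs
  imports Main
begin

text \<open>
  The ordinals are the elements of an arbitrary well-ordered type \<open>'o\<close>; an ordinal
  \<open>\<alpha>\<close>, viewed as the set of smaller ordinals, is the initial segment \<open>{..<\<alpha>}\<close>.
  As \<open>\<kappa>\<close> is itself an element of \<open>'o\<close>, every ordinal \<open>\<le> \<kappa>\<close> is represented, and
  ordinals of \<open>'o\<close> above \<open>\<kappa>\<close>, if any, play no role.
\<close>

definition ord_zero :: "'o::wellorder" where
  "ord_zero = (LEAST \<alpha>. True)"

text \<open>Meaningful for bounded sets only; the supremum of the empty set is zero.\<close>

definition ord_sup :: "'o::wellorder set \<Rightarrow> 'o" where
  "ord_sup A = (LEAST \<alpha>. \<forall>\<beta>\<in>A. \<beta> \<le> \<alpha>)"

definition infinite_regular_cardinal :: "'o::wellorder \<Rightarrow> bool" where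
  "infinite_regular_cardinal \<kappa> \<longleftrightarrow>
     Cinfinite (relation_of (\<le>) {..<\<kappa>}) \<and> regularCard (relation_of (\<le>) {..<\<kappa>})"

definition acc :: "'o::wellorder set \<Rightarrow> 'o set" where
  "acc A = {\<alpha> \<in> A. ord_zero < \<alpha> \<and> ord_sup (A \<inter> {..<\<alpha>}) = \<alpha>}"

text \<open>Only used for limit ordinals \<open>\<alpha>\<close>, including \<open>\<kappa>\<close> itself.\<close>

definition club_in :: "'o::wellorder \<Rightarrow> 'o set \<Rightarrow> bool" where
  "club_in \<alpha> D \<longleftrightarrow>
     D \<subseteq> {..<\<alpha>} \<and>
     (\<forall>\<beta><\<alpha>. \<exists>\<gamma>\<in>D. \<beta> \<le> \<gamma>) \<and>
     (\<forall>\<beta><\<alpha>. ord_zero < \<beta> \<and> ord_sup (D \<inter> {..<\<beta>}) = \<beta> \<longrightarrow> \<beta> \<in> D)"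

definition stationary_in :: "'o::wellorder \<Rightarrow> 'o set \<Rightarrow> bool" where
  "stationary_in \<kappa> S \<longleftrightarrow> S \<subseteq> {..<\<kappa>} \<and> (\<forall>D. club_in \<kappa> D \<longrightarrow> S \<inter> D \<noteq> {})"

definition square_seq :: "'o::wellorder \<Rightarrow> ('o \<Rightarrow> 'o set) \<Rightarrow> bool" where
  "square_seq \<kappa> D \<longleftrightarrow>
     (\<forall>\<alpha>\<in>acc {..<\<kappa>}. club_in \<alpha> (D \<alpha>)) \<and>
     (\<forall>\<alpha>\<in>acc {..<\<kappa>}. \<forall>\<beta>\<in>acc {..<\<kappa>}. \<alpha> \<in> acc (D \<beta>) \<longrightarrow> D \<alpha> = D \<beta> \<inter> {..<\<alpha>}) \<and>
     \<not> (\<exists>E. club_in \<kappa> E \<and> (\<forall>\<alpha>\<in>acc E. E \<inter> {..<\<alpha>} = D \<alpha>))"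

definition square :: "'o::wellorder \<Rightarrow> bool" where
  "square \<kappa> \<longleftrightarrow> (\<exists>D. square_seq \<kappa> D)"

text \<open>
  The matrix consists of the entries \<open>C \<alpha> i\<close> with \<open>\<alpha> \<in> acc {..<\<kappa>}\<close> and \<open>\<iota> \<alpha> \<le> i < \<mu>\<close>, where
  \<open>\<iota> \<alpha>\<close> is the index usually written \<open>i(\<alpha>)\<close>; all other values of \<open>C\<close> and \<open>\<iota>\<close> are
  irrelevant. The width of the matrix, usually written lambda, is called \<open>\<mu>\<close>
  because the symbol for lambda is reserved for abstraction.
\<close>

definition square_ind_seq ::
    "'o::wellorder \<Rightarrow> 'o \<Rightarrow> ('o \<Rightarrow> 'o) \<Rightarrow> ('o \<Rightarrow> 'o \<Rightarrow> 'o set) \<Rightarrow> bool" where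
  "square_ind_seq \<kappa> \<mu> \<iota> C \<longleftrightarrow>
     (\<forall>\<alpha>\<in>acc {..<\<kappa>}. \<iota> \<alpha> < \<mu>) \<and>
     (\<forall>\<alpha>\<in>acc {..<\<kappa>}. \<forall>i. \<iota> \<alpha> \<le> i \<and> i < \<mu> \<longrightarrow> club_in \<alpha> (C \<alpha> i)) \<and>
     (\<forall>\<alpha>\<in>acc {..<\<kappa>}. \<forall>i j. \<iota> \<alpha> \<le> i \<and> i < j \<and> j < \<mu> \<longrightarrow> C \<alpha> i \<subseteq> C \<alpha> j) \<and>
     (\<forall>\<alpha>\<in>acc {..<\<kappa>}. \<forall>\<beta>\<in>acc {..<\<kappa>}. \<forall>i. \<iota> \<beta> \<le> i \<and> i < \<mu> \<longrightarrow>
        \<alpha> \<in> acc (C \<beta> i) \<longrightarrow> \<iota> \<alpha> \<le> i \<and> C \<alpha> i = C \<beta> i \<inter> {..<\<alpha>}) \<and>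
     (\<forall>\<alpha>\<in>acc {..<\<kappa>}. \<forall>\<beta>\<in>acc {..<\<kappa>}. \<alpha> < \<beta> \<longrightarrow>
        (\<exists>i. \<iota> \<beta> \<le> i \<and> i < \<mu> \<and> \<alpha> \<in> acc (C \<beta> i))) \<and>
     \<not> (\<exists>D. club_in \<kappa> D \<and>
          (\<forall>\<alpha>\<in>acc D. \<exists>i. \<iota> \<alpha> \<le> i \<and> i < \<mu> \<and> C \<alpha> i = D \<inter> {..<\<alpha>}))"

end

theory Submission
  imports Defs
begin

text \<open>
  The proof has two ingredients: a colouring of the limit ordinals below \<open>\<kappa>\<close> that supplies the
  function \<open>i(\<alpha>)\<close>, and a recursive construction of the matrix in which the rows of smaller ordinals
  are glued along ladders.

  \<^bold>\<open>The colouring.\<close> For a square sequence \<open>D\<close> on \<open>\<kappa>\<close> and \<open>\<epsilon> < \<alpha>\<close>, the least element of \<open>D \<alpha>\<close> above \<open>\<epsilon>\<close>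
  does not change on passing from \<open>\<beta>\<close> to any \<open>\<alpha> \<in> acc (D \<beta>)\<close> above \<open>\<epsilon>\<close>, because \<open>D \<alpha>\<close> is then an
  initial segment of \<open>D \<beta>\<close>. For a suitable \<open>\<epsilon>\<close>, this
  function of \<open>\<alpha>\<close> has unboundedly many values that it takes on stationary subsets of \<open>S\<close>
  (\<open>next_above_splits\<close>): otherwise the values at \<open>\<epsilon>\<close> are bounded by some \<open>g \<epsilon>\<close> at stationarily many \<open>\<alpha>\<close>
  and for all \<open>\<epsilon> < \<alpha>\<close> at once, so that all closure points of \<open>g\<close> below \<open>\<alpha>\<close> lie in \<open>acc (D \<alpha>)\<close>; then the
  sets \<open>D \<gamma>\<close> at the closure points cohere, and their union is a thread through \<open>D\<close>. As \<open>\<kappa>\<close> is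
  regular, there are at least \<open>\<mu>\<close> such values, and collapsing them onto \<open>\<mu>\<close> gives a
  colouring \<open>c\<close> with values below \<open>\<mu>\<close>, constant on each \<open>acc (D \<alpha>) \<union> {\<alpha>}\<close>, every colour of which is
  stationary in \<open>S\<close> (\<open>coherent_colouring_exists\<close>). For the constancy one first cuts \<open>{..\<epsilon>}\<close> off
  the sets \<open>D \<alpha>\<close>. The index function is \<open>c\<close>.

  \<^bold>\<open>The matrix.\<close> Fix in each limit \<open>\<alpha>\<close> a cofinal set \<open>X \<alpha>\<close> that starts with \<open>acc (D \<alpha>)\<close> and, if that is
  bounded in \<open>\<alpha>\<close>, continues with a cofinal sequence of type omega. The set \<open>C \<alpha> i\<close> consists
  of \<open>X \<alpha>\<close> and of the sets \<open>C \<xi> i\<close> for those limits \<open>\<xi> \<in> X \<alpha>\<close> that \<open>i\<close> is large enough to see: the entry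
  \<open>C \<xi> i\<close> exists and already has all smaller elements of \<open>X \<alpha>\<close> as accumulation points. These \<open>\<xi>\<close> form an
  initial segment of the limits in \<open>X \<alpha>\<close>, the entries \<open>C \<xi> i\<close> end-extend each other, and beyond them only an
  omega-sequence is added, which creates no accumulation points. Coherence follows
  (\<open>coherent_at_step\<close>), and since \<open>c\<close> is constant along \<open>acc (D \<alpha>)\<close>, all of \<open>acc (D \<alpha>)\<close> is seen from
  the very first index. As \<open>i\<close> grows, each \<open>\<xi>\<close> is seen eventually, only finitely many new conditions being
  involved; hence every limit below \<open>\<alpha>\<close> enters some \<open>acc (C \<alpha> i)\<close> (\<open>matrix_covers\<close>).

  \<^bold>\<open>No thread.\<close> A club \<open>E\<close> threading the matrix would agree with \<open>C \<alpha> i\<close> for one fixed \<open>i\<close> and cofinally many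
  \<open>\<alpha>\<close>, so every point of \<open>acc E\<close> would have colour at most \<open>i\<close>. But \<open>\<mu>\<close> is a limit, so there is a larger
  colour; its ordinals form a stationary set, which meets \<open>acc E\<close> (\<open>no_matrix_thread\<close>).
\<close>

unbundle cardinal_syntax

section \<open>Accumulation points and clubs\<close>

text \<open>
  Limit points are needed relative to sets that do not contain them, so this notion leaves out the
  membership required by \<open>acc\<close>. As \<open>ord_zero < \<alpha>\<close> is demanded, \<open>A \<inter> {..<\<alpha>}\<close> is nonempty.
\<close>

definition accumulates :: "'o::wellorder set \<Rightarrow> 'o \<Rightarrow> bool" where
  "accumulates A \<alpha> \<longleftrightarrow> ord_zero < \<alpha> \<and> (\<forall>\<beta><\<alpha>. \<exists>\<gamma>\<in>A. \<beta> < \<gamma> \<and> \<gamma> < \<alpha>)"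

lemma ord_zero_le: "ord_zero \<le> (\<alpha>::'o::wellorder)"
  by (simp add: ord_zero_def Least_le)

lemma ord_sup_below_iff:
  fixes \<alpha> :: "'o::wellorder"
  shows "ord_sup (A \<inter> {..<\<alpha>}) = \<alpha> \<longleftrightarrow> (\<forall>\<beta><\<alpha>. \<exists>\<gamma>\<in>A. \<beta> < \<gamma> \<and> \<gamma> < \<alpha>)"
proof
  assume sup: "ord_sup (A \<inter> {..<\<alpha>}) = \<alpha>"
  show "\<forall>\<beta><\<alpha>. \<exists>\<gamma>\<in>A. \<beta> < \<gamma> \<and> \<gamma> < \<alpha>"
  proof (intro allI impI)
    fix \<beta> assume "\<beta> < \<alpha>"
    then have "\<not> (\<forall>\<gamma>\<in>A \<inter> {..<\<alpha>}. \<gamma> \<le> \<beta>)"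
      using not_less_Least[of \<beta> "\<lambda>\<delta>. \<forall>\<gamma>\<in>A \<inter> {..<\<alpha>}. \<gamma> \<le> \<delta>"]
      unfolding sup[unfolded ord_sup_def] by blast
    then show "\<exists>\<gamma>\<in>A. \<beta> < \<gamma> \<and> \<gamma> < \<alpha>" by (auto simp: not_le)
  qed
next
  assume cof: "\<forall>\<beta><\<alpha>. \<exists>\<gamma>\<in>A. \<beta> < \<gamma> \<and> \<gamma> < \<alpha>"
  show "ord_sup (A \<inter> {..<\<alpha>}) = \<alpha>"
    unfolding ord_sup_def
  proof (rule Least_equality)
    show "\<alpha> \<le> \<beta>" if "\<forall>\<gamma>\<in>A \<inter> {..<\<alpha>}. \<gamma> \<le> \<beta>" for \<beta>
    proof (rule ccontr)
      assume "\<not> \<alpha> \<le> \<beta>"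
      then obtain \<gamma> where "\<gamma> \<in> A" "\<beta> < \<gamma>" "\<gamma> < \<alpha>" using cof by (auto simp: not_le)
      then have "\<gamma> \<le> \<beta>" using that by simp
      then show False using \<open>\<beta> < \<gamma>\<close> by simp
    qed
  qed auto
qed

lemma acc_iff: "\<alpha> \<in> acc A \<longleftrightarrow> \<alpha> \<in> A \<and> accumulates A \<alpha>"
  by (auto simp: acc_def accumulates_def ord_sup_below_iff)

lemma club_in_iff:
  "club_in \<alpha> D \<longleftrightarrow> D \<subseteq> {..<\<alpha>} \<and> (\<forall>\<beta><\<alpha>. \<exists>\<gamma>\<in>D. \<beta> \<le> \<gamma>) \<and>
     (\<forall>\<beta><\<alpha>. accumulates D \<beta> \<longrightarrow> \<beta> \<in> D)"
  by (auto simp: club_in_def accumulates_def ord_sup_below_iff)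

lemma accumulates_mono: "accumulates A \<alpha> \<Longrightarrow> A \<subseteq> B \<Longrightarrow> accumulates B \<alpha>"
  unfolding accumulates_def by (meson subsetD)

lemma acc_mono: "A \<subseteq> B \<Longrightarrow> acc A \<subseteq> acc B"
  by (auto simp: acc_iff elim: accumulates_mono)

lemma accumulates_initial:
  assumes "\<beta> \<le> \<alpha>"
  shows "accumulates (A \<inter> {..<\<alpha>}) \<beta> \<longleftrightarrow> accumulates A \<beta>"
proof
  assume acc: "accumulates A \<beta>"
  show "accumulates (A \<inter> {..<\<alpha>}) \<beta>"
    unfolding accumulates_def
  proof (intro conjI allI impI)
    show "ord_zero < \<beta>" using acc by (simp add: accumulates_def)
    fix \<eta> assume "\<eta> < \<beta>"
    then obtain \<gamma> where "\<gamma> \<in> A" "\<eta> < \<gamma>" "\<gamma> < \<beta>" using acc unfolding accumulates_def by blast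
    then show "\<exists>\<gamma>\<in>A \<inter> {..<\<alpha>}. \<eta> < \<gamma> \<and> \<gamma> < \<beta>"
      using assms by (intro bexI[of _ \<gamma>]) auto
  qed
qed (erule accumulates_mono, simp)

lemma acc_initial: "acc (A \<inter> {..<\<alpha>}) = acc A \<inter> {..<\<alpha>}"
  by (auto simp: acc_iff accumulates_initial)

lemma limits_initial:
  assumes "\<alpha> \<le> \<kappa>"
  shows "acc {..<\<alpha>} = acc {..<\<kappa>} \<inter> {..<\<alpha>}"
proof -
  have "{..<\<kappa>} \<inter> {..<\<alpha>} = {..<\<alpha>}" using assms by auto
  with acc_initial[of "{..<\<kappa>}" \<alpha>] show ?thesis by (simp only:)
qed

lemma limitsD:
  "\<alpha> \<in> acc {..<\<kappa>} \<Longrightarrow> \<alpha> < \<kappa>"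
  "\<alpha> \<in> acc {..<\<kappa>} \<Longrightarrow> ord_zero < \<alpha>"
  "\<alpha> \<in> acc {..<\<kappa>} \<Longrightarrow> \<beta> < \<alpha> \<Longrightarrow> \<exists>\<gamma>>\<beta>. \<gamma> < \<alpha>"
  by (auto simp: acc_iff accumulates_def)

lemma limitsI: "\<alpha> < \<kappa> \<Longrightarrow> accumulates A \<alpha> \<Longrightarrow> \<alpha> \<in> acc {..<\<kappa>}"
  by (fastforce simp: acc_iff accumulates_def)

lemma club_subset: "club_in \<alpha> D \<Longrightarrow> D \<subseteq> {..<\<alpha>}"
  and club_unbounded: "club_in \<alpha> D \<Longrightarrow> \<beta> < \<alpha> \<Longrightarrow> \<exists>\<gamma>\<in>D. \<beta> \<le> \<gamma>"
  and club_closed: "club_in \<alpha> D \<Longrightarrow> \<beta> < \<alpha> \<Longrightarrow> accumulates D \<beta> \<Longrightarrow> \<beta> \<in> D"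
  by (auto simp: club_in_iff)

lemma club_accumulates:
  assumes "club_in \<alpha> D" "\<alpha> \<in> acc {..<\<kappa>}"
  shows "accumulates D \<alpha>"
  unfolding accumulates_def
proof (intro conjI allI impI)
  show "ord_zero < \<alpha>" using assms(2) by (rule limitsD)
  fix \<beta> assume "\<beta> < \<alpha>"
  then obtain \<gamma> where "\<beta> < \<gamma>" "\<gamma> < \<alpha>" using limitsD(3)[OF assms(2)] by blast
  moreover from \<open>\<gamma> < \<alpha>\<close> obtain \<delta> where "\<delta> \<in> D" "\<gamma> \<le> \<delta>"
    using club_unbounded[OF assms(1)] by blast
  ultimately show "\<exists>\<gamma>\<in>D. \<beta> < \<gamma> \<and> \<gamma> < \<alpha>"
    using club_subset[OF assms(1)] by (intro bexI[of _ \<delta>]) auto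
qed

section \<open>Clubs below an uncountable regular ordinal\<close>

text \<open>
  The two closure properties of an uncountable regular cardinal that the arguments about clubs consume,
  free of cardinal arithmetic: images of smaller ordinals are bounded, and so are sequences.
\<close>

locale uncountable_regular =
  fixes \<kappa> :: "'o::wellorder"
  assumes zero_less: "ord_zero < \<kappa>"
    and image_bounded: "\<alpha> < \<kappa> \<Longrightarrow> \<forall>\<xi><\<alpha>. f \<xi> < \<kappa> \<Longrightarrow> \<exists>\<beta><\<kappa>. \<forall>\<xi><\<alpha>. f \<xi> < \<beta>"
    and sequence_bounded: "\<forall>n::nat. s n < \<kappa> \<Longrightarrow> \<exists>\<beta><\<kappa>. \<forall>n. s n < \<beta>"
begin

lemma above: "\<beta> < \<kappa> \<Longrightarrow> \<exists>\<gamma>>\<beta>. \<gamma> < \<kappa>"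
  using sequence_bounded[of "\<lambda>_. \<beta>"] by auto

lemma club_above: "club_in \<kappa> D \<Longrightarrow> \<beta> < \<kappa> \<Longrightarrow> \<exists>\<gamma>\<in>D. \<beta> < \<gamma>"
  using above[of \<beta>] club_unbounded[of \<kappa> D] less_le_trans by blast

text \<open>
  Iterate \<open>omega\<close> times a function that dominates \<open>H\<close> on initial segments; the supremum of the iterates is
  below \<open>\<kappa>\<close> and closed under \<open>H\<close>.
\<close>

lemma closure_point:
  assumes H: "\<And>\<xi>. \<xi> < \<kappa> \<Longrightarrow> H \<xi> < \<kappa>" and "\<beta> < \<kappa>"
  shows "\<exists>\<alpha><\<kappa>. \<beta> < \<alpha> \<and> (\<forall>\<xi><\<alpha>. H \<xi> < \<alpha>)"
proof -
  have "\<exists>\<gamma><\<kappa>. \<eta> < \<gamma> \<and> (\<forall>\<xi><\<eta>. H \<xi> < \<gamma>)" if \<eta>: "\<eta> < \<kappa>" for \<eta>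
  proof -
    obtain \<gamma> where "\<gamma> < \<kappa>" "\<forall>\<xi><\<eta>. H \<xi> < \<gamma>"
      using image_bounded[OF \<eta>, of H] H less_trans[OF _ \<eta>] by blast
    moreover obtain \<gamma>' where "\<eta> < \<gamma>'" "\<gamma>' < \<kappa>" using above \<eta> by blast
    ultimately show ?thesis by (intro exI[of _ "max \<gamma> \<gamma>'"]) (auto simp: less_max_iff_disj)
  qed
  then obtain N where N: "\<And>\<eta>. \<eta> < \<kappa> \<Longrightarrow> N \<eta> < \<kappa> \<and> \<eta> < N \<eta> \<and> (\<forall>\<xi><\<eta>. H \<xi> < N \<eta>)"
    using choice[of "\<lambda>\<eta> \<gamma>. \<eta> < \<kappa> \<longrightarrow> \<gamma> < \<kappa> \<and> \<eta> < \<gamma> \<and> (\<forall>\<xi><\<eta>. H \<xi> < \<gamma>)"] by blast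
  define s where "s n = (N ^^ n) \<beta>" for n :: nat
  have s: "s n < \<kappa>" for n by (induction n) (auto simp: s_def assms N)
  have step: "s n < s (Suc n)" "\<forall>\<xi><s n. H \<xi> < s (Suc n)" for n
    using N[OF s[of n]] by (auto simp: s_def)
  define \<alpha> where "\<alpha> = (LEAST \<alpha>. \<forall>n. s n < \<alpha>)"
  obtain b where b: "b < \<kappa>" "\<forall>n. s n < b" using sequence_bounded[of s] s by blast
  have up: "\<forall>n. s n < \<alpha>" unfolding \<alpha>_def using b(2) by (rule LeastI)
  have "\<alpha> \<le> b" unfolding \<alpha>_def using b(2) by (rule Least_le)
  moreover have "H \<xi> < \<alpha>" if \<xi>: "\<xi> < \<alpha>" for \<xi>
  proof -
    obtain n where "\<xi> \<le> s n"
      using \<xi> not_less_Least[of \<xi> "\<lambda>\<alpha>. \<forall>n. s n < \<alpha>"] by (auto simp: \<alpha>_def not_less)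
    then have "\<xi> < s (Suc n)" using step(1) by (rule le_less_trans)
    then show ?thesis using step(2)[of "Suc n"] up less_trans by blast
  qed
  moreover have "\<beta> < \<alpha>" using up[rule_format, of 0] by (simp add: s_def)
  ultimately show ?thesis using le_less_trans[OF _ b(1)] by blast
qed

text \<open>
  Closure points of a function are cofinal in \<open>\<kappa>\<close>, so for unboundedness it is enough to name a function \<open>H\<close> whose
  limit closure points belong to the set.
\<close>

lemma club_if_closure_points:
  assumes "D \<subseteq> {..<\<kappa>}" and "\<And>\<beta>. \<beta> < \<kappa> \<Longrightarrow> accumulates D \<beta> \<Longrightarrow> \<beta> \<in> D"
    and H: "\<And>\<xi>. \<xi> < \<kappa> \<Longrightarrow> H \<xi> < \<kappa>"
    and D: "\<And>\<alpha>. \<alpha> \<in> acc {..<\<kappa>} \<Longrightarrow> \<forall>\<xi><\<alpha>. H \<xi> < \<alpha> \<Longrightarrow> \<alpha> \<in> D"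
  shows "club_in \<kappa> D"
  unfolding club_in_iff
proof (intro conjI allI impI)
  fix \<beta> assume "\<beta> < \<kappa>"
  \<comment> \<open>closure under \<open>N\<close> makes the closure point a limit\<close>
  obtain N where N: "\<xi> < N \<xi> \<and> N \<xi> < \<kappa>" if "\<xi> < \<kappa>" for \<xi>
    using choice[of "\<lambda>\<xi> \<gamma>. \<xi> < \<kappa> \<longrightarrow> \<xi> < \<gamma> \<and> \<gamma> < \<kappa>"] above by blast
  obtain \<alpha> where \<alpha>: "\<alpha> < \<kappa>" "\<beta> < \<alpha>" and cl: "\<forall>\<xi><\<alpha>. max (N \<xi>) (H \<xi>) < \<alpha>"
    using closure_point[of "\<lambda>\<xi>. max (N \<xi>) (H \<xi>)" \<beta>] N H \<open>\<beta> < \<kappa>\<close> by auto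
  have "accumulates {..<\<kappa>} \<alpha>"
    unfolding accumulates_def
  proof (intro conjI allI impI)
    show "ord_zero < \<alpha>" using ord_zero_le \<alpha>(2) by (rule le_less_trans)
    fix \<xi> assume "\<xi> < \<alpha>"
    then have "\<xi> < \<kappa>" using \<alpha>(1) by (rule less_trans)
    then show "\<exists>\<gamma>\<in>{..<\<kappa>}. \<xi> < \<gamma> \<and> \<gamma> < \<alpha>"
      using N[of \<xi>] cl \<open>\<xi> < \<alpha>\<close> by (intro bexI[of _ "N \<xi>"]) auto
  qed
  then have "\<alpha> \<in> D" using D limitsI[OF \<alpha>(1)] cl by simp
  then show "\<exists>\<gamma>\<in>D. \<beta> \<le> \<gamma>" using less_imp_le[OF \<alpha>(2)] by blast
qed (use assms in auto)

lemma club_next: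
  assumes "club_in \<kappa> D"
  obtains N where "\<And>\<xi>. \<xi> < \<kappa> \<Longrightarrow> N \<xi> \<in> D \<and> \<xi> < N \<xi> \<and> N \<xi> < \<kappa>"
proof -
  have "\<forall>\<xi>. \<exists>\<gamma>. \<xi> < \<kappa> \<longrightarrow> \<gamma> \<in> D \<and> \<xi> < \<gamma> \<and> \<gamma> < \<kappa>"
    using club_above[OF assms] club_subset[OF assms] by blast
  from choice[OF this] show ?thesis using that by blast
qed

lemma accumulates_closure_point:
  assumes "\<And>\<xi>. \<xi> < \<kappa> \<Longrightarrow> N \<xi> \<in> D \<and> \<xi> < N \<xi>"
    and "\<alpha> \<in> acc {..<\<kappa>}" "\<And>\<xi>. \<xi> < \<alpha> \<Longrightarrow> N \<xi> < \<alpha>"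
  shows "accumulates D \<alpha>"
  unfolding accumulates_def
  using assms(1,3) limitsD(2)[OF assms(2)] less_trans[OF _ limitsD(1)[OF assms(2)]] by blast

lemma club_Int:
  assumes A: "club_in \<kappa> A" and B: "club_in \<kappa> B"
  shows "club_in \<kappa> (A \<inter> B)"
proof -
  obtain a where a: "\<And>\<xi>. \<xi> < \<kappa> \<Longrightarrow> a \<xi> \<in> A \<and> \<xi> < a \<xi> \<and> a \<xi> < \<kappa>" using club_next[OF A] by blast
  obtain b where b: "\<And>\<xi>. \<xi> < \<kappa> \<Longrightarrow> b \<xi> \<in> B \<and> \<xi> < b \<xi> \<and> b \<xi> < \<kappa>" using club_next[OF B] by blast
  show ?thesis
  proof (rule club_if_closure_points[where H = "\<lambda>\<xi>. max (a \<xi>) (b \<xi>)"])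
    show "A \<inter> B \<subseteq> {..<\<kappa>}" using club_subset[OF A] by auto
    show "\<beta> \<in> A \<inter> B" if "\<beta> < \<kappa>" "accumulates (A \<inter> B) \<beta>" for \<beta>
      using club_closed[OF A that(1)] club_closed[OF B that(1)]
        accumulates_mono[OF that(2) Int_lower1] accumulates_mono[OF that(2) Int_lower2] by blast
    show "max (a \<xi>) (b \<xi>) < \<kappa>" if "\<xi> < \<kappa>" for \<xi> using a b that by simp
    show "\<alpha> \<in> A \<inter> B" if "\<alpha> \<in> acc {..<\<kappa>}" "\<forall>\<xi><\<alpha>. max (a \<xi>) (b \<xi>) < \<alpha>" for \<alpha>
    proof -
      have "accumulates A \<alpha>" "accumulates B \<alpha>"
        using accumulates_closure_point[of a A \<alpha>] accumulates_closure_point[of b B \<alpha>] a b that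
        by auto
      then show ?thesis using club_closed[OF A] club_closed[OF B] limitsD(1)[OF that(1)] by blast
    qed
  qed
qed

lemma club_tail:
  assumes "\<gamma> < \<kappa>"
  shows "club_in \<kappa> {\<gamma><..<\<kappa>}"
proof (rule club_if_closure_points[where H = "\<lambda>_. \<gamma>"])
  show "\<beta> \<in> {\<gamma><..<\<kappa>}" if \<beta>: "\<beta> < \<kappa>" "accumulates {\<gamma><..<\<kappa>} \<beta>" for \<beta>
  proof -
    obtain \<delta> where "\<delta> \<in> {\<gamma><..<\<kappa>}" "\<delta> < \<beta>" using \<beta>(2) unfolding accumulates_def by blast
    then show ?thesis using \<beta>(1) by auto
  qed
  show "\<alpha> \<in> {\<gamma><..<\<kappa>}" if \<alpha>: "\<alpha> \<in> acc {..<\<kappa>}" "\<forall>\<xi><\<alpha>. \<gamma> < \<alpha>" for \<alpha>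
    using \<alpha>(2) limitsD(1,2)[OF \<alpha>(1)] by auto
qed (use assms in auto)

lemma club_acc:
  assumes D: "club_in \<kappa> D"
  shows "club_in \<kappa> (acc D)"
proof -
  obtain N where N: "\<And>\<xi>. \<xi> < \<kappa> \<Longrightarrow> N \<xi> \<in> D \<and> \<xi> < N \<xi> \<and> N \<xi> < \<kappa>" using club_next[OF D] by blast
  have sub: "acc D \<subseteq> D" by (auto simp: acc_iff)
  show ?thesis
  proof (rule club_if_closure_points[where H = N])
    show "acc D \<subseteq> {..<\<kappa>}" using sub club_subset[OF D] by auto
    show "\<beta> \<in> acc D" if "\<beta> < \<kappa>" "accumulates (acc D) \<beta>" for \<beta>
      using accumulates_mono[OF that(2) sub] club_closed[OF D that(1)] by (simp add: acc_iff)
    show "N \<xi> < \<kappa>" if "\<xi> < \<kappa>" for \<xi> using N that by simp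
    show "\<alpha> \<in> acc D" if "\<alpha> \<in> acc {..<\<kappa>}" "\<forall>\<xi><\<alpha>. N \<xi> < \<alpha>" for \<alpha>
    proof -
      have "accumulates D \<alpha>" using accumulates_closure_point[of N D \<alpha>] N that by blast
      then show ?thesis using club_closed[OF D] limitsD(1)[OF that(1)] by (simp add: acc_iff)
    qed
  qed
qed

text \<open>
  For the function \<open>H\<close>, it suffices to bound at \<open>\<xi>\<close> the next elements after \<open>\<xi>\<close> of the sets \<open>E \<epsilon>\<close> with
  \<open>\<epsilon> \<le> \<xi>\<close>: for arbitrary \<open>\<epsilon>\<close> and \<open>\<eta>\<close> below a closure point, take \<open>\<xi>\<close> to be their maximum.
\<close>

lemma club_diagonal:
  assumes E: "\<And>\<epsilon>. \<epsilon> < \<kappa> \<Longrightarrow> club_in \<kappa> (E \<epsilon>)"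
  shows "club_in \<kappa> {\<alpha>. \<alpha> < \<kappa> \<and> (\<forall>\<epsilon><\<alpha>. \<alpha> \<in> E \<epsilon>)}" (is "club_in \<kappa> ?D")
proof -
  have "\<forall>\<epsilon>. \<exists>N. \<epsilon> < \<kappa> \<longrightarrow> (\<forall>\<xi><\<kappa>. N \<xi> \<in> E \<epsilon> \<and> \<xi> < N \<xi> \<and> N \<xi> < \<kappa>)"
    using club_next[OF E] by blast
  from choice[OF this] obtain N
    where N: "\<And>\<epsilon> \<xi>. \<epsilon> < \<kappa> \<Longrightarrow> \<xi> < \<kappa> \<Longrightarrow> N \<epsilon> \<xi> \<in> E \<epsilon> \<and> \<xi> < N \<epsilon> \<xi> \<and> N \<epsilon> \<xi> < \<kappa>"
    by blast
  have "\<exists>\<gamma><\<kappa>. \<forall>\<epsilon>\<le>\<xi>. N \<epsilon> \<xi> < \<gamma>" if \<xi>: "\<xi> < \<kappa>" for \<xi>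
  proof -
    obtain \<gamma> where "\<gamma> < \<kappa>" "\<forall>\<epsilon><\<xi>. N \<epsilon> \<xi> < \<gamma>"
      using image_bounded[OF \<xi>, of "\<lambda>\<epsilon>. N \<epsilon> \<xi>"] N[OF _ \<xi>] less_trans[OF _ \<xi>] by blast
    moreover obtain \<gamma>' where "N \<xi> \<xi> < \<gamma>'" "\<gamma>' < \<kappa>" using above N \<xi> by blast
    ultimately show ?thesis
      by (intro exI[of _ "max \<gamma> \<gamma>'"]) (auto simp: less_max_iff_disj le_less)
  qed
  then have "\<forall>\<xi>. \<exists>\<gamma>. \<xi> < \<kappa> \<longrightarrow> \<gamma> < \<kappa> \<and> (\<forall>\<epsilon>\<le>\<xi>. N \<epsilon> \<xi> < \<gamma>)" by blast
  from choice[OF this] obtain H where H: "\<And>\<xi>. \<xi> < \<kappa> \<Longrightarrow> H \<xi> < \<kappa> \<and> (\<forall>\<epsilon>\<le>\<xi>. N \<epsilon> \<xi> < H \<xi>)"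
    by blast
  show ?thesis
  proof (rule club_if_closure_points[where H = H])
    show "\<beta> \<in> ?D" if "\<beta> < \<kappa>" "accumulates ?D \<beta>" for \<beta>
    proof -
      have "\<beta> \<in> E \<epsilon>" if \<epsilon>: "\<epsilon> < \<beta>" for \<epsilon>
      proof (rule club_closed)
        show "club_in \<kappa> (E \<epsilon>)" using E less_trans[OF \<epsilon> \<open>\<beta> < \<kappa>\<close>] by blast
        show "\<beta> < \<kappa>" by fact
        show "accumulates (E \<epsilon>) \<beta>"
          unfolding accumulates_def
        proof (intro conjI allI impI)
          show "ord_zero < \<beta>" using \<open>accumulates ?D \<beta>\<close> by (simp add: accumulates_def)
          fix \<eta> assume "\<eta> < \<beta>"
          then have "max \<eta> \<epsilon> < \<beta>" using \<epsilon> by simp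
          then obtain \<gamma> where "\<gamma> \<in> ?D" "max \<eta> \<epsilon> < \<gamma>" "\<gamma> < \<beta>"
            using \<open>accumulates ?D \<beta>\<close> unfolding accumulates_def by blast
          then show "\<exists>\<gamma>\<in>E \<epsilon>. \<eta> < \<gamma> \<and> \<gamma> < \<beta>" by auto
        qed
      qed
      then show ?thesis using that(1) by blast
    qed
    show "\<alpha> \<in> ?D" if "\<alpha> \<in> acc {..<\<kappa>}" "\<forall>\<xi><\<alpha>. H \<xi> < \<alpha>" for \<alpha>
    proof -
      note \<alpha> = limitsD(1,2)[OF that(1)]
      have "accumulates (E \<epsilon>) \<alpha>" if \<epsilon>: "\<epsilon> < \<alpha>" for \<epsilon>
        unfolding accumulates_def
      proof (intro conjI allI impI \<alpha>(2))
        fix \<eta> assume "\<eta> < \<alpha>"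
        then have m: "max \<eta> \<epsilon> < \<alpha>" "max \<eta> \<epsilon> < \<kappa>" using \<epsilon> \<alpha>(1) by auto
        have "N \<epsilon> (max \<eta> \<epsilon>) < H (max \<eta> \<epsilon>)" using H[OF m(2)] by simp
        also have "\<dots> < \<alpha>" using \<open>\<forall>\<xi><\<alpha>. H \<xi> < \<alpha>\<close> m(1) by blast
        finally have "N \<epsilon> (max \<eta> \<epsilon>) < \<alpha>" .
        moreover have "N \<epsilon> (max \<eta> \<epsilon>) \<in> E \<epsilon>" "max \<eta> \<epsilon> < N \<epsilon> (max \<eta> \<epsilon>)"
          using N[OF _ m(2), of \<epsilon>] less_trans[OF \<epsilon> \<alpha>(1)] by auto
        ultimately show "\<exists>\<gamma>\<in>E \<epsilon>. \<eta> < \<gamma> \<and> \<gamma> < \<alpha>" by auto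
      qed
      then show ?thesis using club_closed[OF E] \<alpha>(1) less_trans[OF _ \<alpha>(1)] by blast
    qed
  qed (use H in auto)
qed

end

section \<open>Regular cardinals\<close>

text \<open>
  The consequences of regularity that are used later, with the well-order relation on \<open>{..<\<kappa>}\<close> eliminated.
\<close>

lemma
  fixes \<kappa> :: "'o::wellorder"
  assumes "infinite_regular_cardinal \<kappa>"
  shows infinite_lessThan: "infinite {..<\<kappa>}"
    and lessThan_small: "\<And>\<alpha>. \<alpha> < \<kappa> \<Longrightarrow> |{..<\<alpha>}| <o |{..<\<kappa>}|"
    and no_largest: "\<And>\<alpha>. \<alpha> < \<kappa> \<Longrightarrow> \<exists>\<beta>>\<alpha>. \<beta> < \<kappa>"
    and unbounded_large: "\<And>K. K \<subseteq> {..<\<kappa>} \<Longrightarrow> \<forall>\<alpha><\<kappa>. \<exists>\<beta>\<in>K. \<alpha> < \<beta> \<Longrightarrow> |K| =o |{..<\<kappa>}|"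
proof -
  define r where "r = relation_of (\<le>) {..<\<kappa>}"
  have field: "Field r = {..<\<kappa>}" by (auto simp: r_def relation_of_def Field_def)
  have card: "Card_order r" and "cinfinite r" and reg: "regularCard r"
    using assms unfolding infinite_regular_cardinal_def r_def by auto
  then show inf: "infinite {..<\<kappa>}" by (simp add: cinfinite_def field)
  have iso: "|{..<\<kappa>}| =o r" using card_of_Field_ordIso[OF card] by (simp add: field)
  have under: "underS r \<alpha> = {..<\<alpha>}" if "\<alpha> < \<kappa>" for \<alpha>
    using that by (auto simp: underS_def r_def relation_of_def)
  show "|{..<\<alpha>}| <o |{..<\<kappa>}|" if "\<alpha> < \<kappa>" for \<alpha>
    using card_of_underS[OF card, of \<alpha>] that field under ordLess_ordIso_trans[OF _ ordIso_symmetric[OF iso]]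
    by auto
  show "\<exists>\<beta>>\<alpha>. \<beta> < \<kappa>" if \<alpha>: "\<alpha> < \<kappa>" for \<alpha>
  proof -
    obtain \<beta> where "\<alpha> \<noteq> \<beta>" "(\<alpha>, \<beta>) \<in> r"
      using infinite_Card_order_limit[OF card, of \<alpha>] inf \<alpha> by (auto simp: field)
    then show ?thesis by (intro exI[of _ \<beta>]) (auto simp: r_def relation_of_def)
  qed
  show "|K| =o |{..<\<kappa>}|" if K: "K \<subseteq> {..<\<kappa>}" "\<forall>\<alpha><\<kappa>. \<exists>\<beta>\<in>K. \<alpha> < \<beta>" for K
  proof -
    have "cofinal K r"
      unfolding cofinal_def field
    proof
      fix \<alpha> assume "\<alpha> \<in> {..<\<kappa>}"
      moreover from this obtain \<beta> where "\<beta> \<in> K" "\<alpha> < \<beta>" using K(2) by blast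
      ultimately show "\<exists>\<beta>\<in>K. \<alpha> \<noteq> \<beta> \<and> (\<alpha>, \<beta>) \<in> r"
        using K(1) by (intro bexI[of _ \<beta>]) (auto simp: r_def relation_of_def)
    qed
    then have "|K| =o r" using reg K(1) unfolding regularCard_def field by blast
    then show ?thesis using iso ordIso_symmetric ordIso_transitive by blast
  qed
qed

lemma small_image_bounded:
  fixes \<kappa> :: "'o::wellorder"
  assumes \<kappa>: "infinite_regular_cardinal \<kappa>" and A: "|A| <o |{..<\<kappa>}|" and f: "f ` A \<subseteq> {..<\<kappa>}"
  shows "\<exists>\<beta><\<kappa>. \<forall>a\<in>A. f a < \<beta>"
proof -
  have "\<not> |f ` A| =o |{..<\<kappa>}|"
    using ordLeq_ordLess_trans[OF card_of_image A] not_ordLess_ordIso by blast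
  then obtain \<alpha> where "\<alpha> < \<kappa>" "\<forall>\<beta>\<in>f ` A. \<not> \<alpha> < \<beta>"
    using unbounded_large[OF \<kappa> f] by blast
  then show ?thesis using no_largest[OF \<kappa>, of \<alpha>] by (auto simp: not_less intro: le_less_trans)
qed

lemma uncountable_regularI:
  fixes \<kappa> \<mu> :: "'o::wellorder"
  assumes \<mu>: "infinite_regular_cardinal \<mu>" and \<kappa>: "infinite_regular_cardinal \<kappa>" and "\<mu> < \<kappa>"
  shows "uncountable_regular \<kappa>"
proof
  show "ord_zero < \<kappa>" using \<open>\<mu> < \<kappa>\<close> ord_zero_le le_less_trans by blast
  show "\<exists>\<beta><\<kappa>. \<forall>\<xi><\<alpha>. f \<xi> < \<beta>" if "\<alpha> < \<kappa>" "\<forall>\<xi><\<alpha>. f \<xi> < \<kappa>" for \<alpha> and f :: "'o \<Rightarrow> 'o"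
    using small_image_bounded[OF \<kappa> lessThan_small[OF \<kappa> that(1)], of f] that(2) by auto
  have "|UNIV :: nat set| <o |{..<\<kappa>}|"
    using infinite_lessThan[OF \<mu>] lessThan_small[OF \<kappa> \<open>\<mu> < \<kappa>\<close>]
    by (meson infinite_iff_card_of_nat ordLeq_ordLess_trans)
  then show "\<exists>\<beta><\<kappa>. \<forall>n. s n < \<beta>" if "\<forall>n. s n < \<kappa>" for s :: "nat \<Rightarrow> 'o"
    using small_image_bounded[OF \<kappa>, of UNIV s] that by auto
qed

text \<open>
  An unbounded subset of a regular \<open>\<kappa>\<close> has the size of \<open>\<kappa>\<close>, hence room for \<open>\<mu>\<close> many different elements.
\<close>

lemma unbounded_contains_copy:
  fixes \<kappa> \<mu> :: "'o::wellorder"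
  assumes \<kappa>: "infinite_regular_cardinal \<kappa>" and "\<mu> < \<kappa>"
    and K: "K \<subseteq> {..<\<kappa>}" "\<forall>\<alpha><\<kappa>. \<exists>\<beta>\<in>K. \<alpha> < \<beta>"
  shows "\<exists>f. inj_on f {..<\<mu>} \<and> f ` {..<\<mu>} \<subseteq> K"
proof -
  have "|{..<\<mu>}| <o |K|"
    using lessThan_small[OF \<kappa> \<open>\<mu> < \<kappa>\<close>] unbounded_large[OF \<kappa> K]
    by (meson ordIso_symmetric ordLess_ordIso_trans)
  then show ?thesis using card_of_ordLeq ordLess_imp_ordLeq by blast
qed

section \<open>Coherent sequences of clubs\<close>

text \<open>
  The positive part of being a square sequence, without the absence of threads.
\<close>

definition coherent_on :: "'o::wellorder \<Rightarrow> ('o \<Rightarrow> 'o set) \<Rightarrow> bool" where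
  "coherent_on \<kappa> D \<longleftrightarrow> (\<forall>\<alpha>\<in>acc {..<\<kappa>}. club_in \<alpha> (D \<alpha>)) \<and>
     (\<forall>\<alpha>\<in>acc {..<\<kappa>}. \<forall>\<beta>\<in>acc {..<\<kappa>}. \<alpha> \<in> acc (D \<beta>) \<longrightarrow> D \<alpha> = D \<beta> \<inter> {..<\<alpha>})"

lemma square_seq_iff:
  "square_seq \<kappa> D \<longleftrightarrow> coherent_on \<kappa> D \<and>
     \<not> (\<exists>E. club_in \<kappa> E \<and> (\<forall>\<alpha>\<in>acc E. E \<inter> {..<\<alpha>} = D \<alpha>))"
  by (simp add: square_seq_def coherent_on_def)

context
  fixes \<kappa> :: "'o::wellorder" and D
  assumes coherent: "coherent_on \<kappa> D"
begin

lemma coherent_club: "\<alpha> \<in> acc {..<\<kappa>} \<Longrightarrow> club_in \<alpha> (D \<alpha>)"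
  using coherent by (simp add: coherent_on_def)

lemma coherent_subset: "\<alpha> \<in> acc {..<\<kappa>} \<Longrightarrow> D \<alpha> \<subseteq> {..<\<alpha>}"
  using coherent_club club_subset by blast

lemma coherent_acc:
  assumes "\<beta> \<in> acc {..<\<kappa>}" "\<alpha> \<in> acc (D \<beta>)"
  shows "\<alpha> < \<beta>" "\<alpha> \<in> acc {..<\<kappa>}" "D \<alpha> = D \<beta> \<inter> {..<\<alpha>}" "acc (D \<alpha>) = acc (D \<beta>) \<inter> {..<\<alpha>}"
proof -
  have "\<alpha> \<in> D \<beta>" "accumulates (D \<beta>) \<alpha>" using assms(2) by (auto simp: acc_iff)
  then show "\<alpha> < \<beta>" using coherent_subset[OF assms(1)] by blast
  then show *: "\<alpha> \<in> acc {..<\<kappa>}"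
    using limitsI \<open>accumulates (D \<beta>) \<alpha>\<close> limitsD(1)[OF assms(1)] less_trans by blast
  show "D \<alpha> = D \<beta> \<inter> {..<\<alpha>}" using coherent * assms unfolding coherent_on_def by blast
  then show "acc (D \<alpha>) = acc (D \<beta>) \<inter> {..<\<alpha>}" by (simp add: acc_initial)
qed

end

text \<open>
  If all members of \<open>A\<close> were accumulation points of each other's clubs, the sets \<open>D \<alpha>\<close> for \<open>\<alpha> \<in> A\<close> would
  end-extend each other, and their union would be a thread.
\<close>

lemma no_coherent_unbounded:
  assumes sq: "square_seq \<kappa> D" and A: "A \<subseteq> acc {..<\<kappa>}" "\<forall>\<gamma><\<kappa>. \<exists>\<alpha>\<in>A. \<gamma> < \<alpha>"
  shows "\<exists>\<alpha>\<in>A. \<exists>\<beta>\<in>A. \<alpha> < \<beta> \<and> \<alpha> \<notin> acc (D \<beta>)"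
proof (rule ccontr)
  assume "\<not> ?thesis"
  then have chain: "\<alpha> \<in> acc (D \<beta>)" if "\<alpha> \<in> A" "\<beta> \<in> A" "\<alpha> < \<beta>" for \<alpha> \<beta> using that by blast
  have coh: "coherent_on \<kappa> D" using sq by (simp add: square_seq_iff)
  define T where "T = (\<Union>\<alpha>\<in>A. D \<alpha>)"
  have T: "T \<inter> {..<\<alpha>} = D \<alpha>" if "\<alpha> \<in> A" for \<alpha>
  proof -
    have "D \<alpha> \<subseteq> {..<\<alpha>}" using coherent_subset[OF coh] that A(1) by blast
    moreover have "D \<beta> \<inter> {..<\<alpha>} \<subseteq> D \<alpha>" if "\<beta> \<in> A" for \<beta>
    proof (cases \<alpha> \<beta> rule: linorder_cases)
      case less
      then show ?thesis using coherent_acc(3)[OF coh _ chain] \<open>\<alpha> \<in> A\<close> that A(1) by blast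
    next
      case greater
      then show ?thesis using coherent_acc(3)[OF coh _ chain] \<open>\<alpha> \<in> A\<close> that A(1) by blast
    qed auto
    ultimately show ?thesis using that unfolding T_def by blast
  qed
  have club: "club_in \<alpha> (D \<alpha>)" if "\<alpha> \<in> A" for \<alpha> using coherent_club[OF coh] that A(1) by blast
  have "club_in \<kappa> T"
    unfolding club_in_iff
  proof (intro conjI allI impI)
    show "T \<subseteq> {..<\<kappa>}"
    proof
      fix x assume "x \<in> T"
      then obtain \<alpha> where "\<alpha> \<in> A" "x < \<alpha>"
        unfolding T_def using coherent_subset[OF coh] A(1) by blast
      moreover from this have "\<alpha> < \<kappa>" using limitsD(1) A(1) by blast
      ultimately show "x \<in> {..<\<kappa>}" by simp
    qed
    show "\<exists>\<gamma>\<in>T. \<beta> \<le> \<gamma>" if \<beta>: "\<beta> < \<kappa>" for \<beta>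
    proof -
      obtain \<alpha> where \<alpha>: "\<alpha> \<in> A" "\<beta> < \<alpha>" using A(2) \<beta> by blast
      then show ?thesis using club_unbounded[OF club[OF \<alpha>(1)] \<alpha>(2)] unfolding T_def by blast
    qed
    show "\<beta> \<in> T" if "\<beta> < \<kappa>" "accumulates T \<beta>" for \<beta>
    proof -
      from A(2) \<open>\<beta> < \<kappa>\<close> obtain \<alpha> where \<alpha>: "\<alpha> \<in> A" "\<beta> < \<alpha>" by blast
      then have "accumulates (D \<alpha>) \<beta>"
        using accumulates_initial[of \<beta> \<alpha> T] that(2) T by simp
      then show ?thesis using club_closed[OF club[OF \<alpha>(1)] \<alpha>(2)] \<alpha>(1) unfolding T_def by blast
    qed
  qed
  moreover have "T \<inter> {..<\<beta>} = D \<beta>" if "\<beta> \<in> acc T" for \<beta>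
  proof -
    have "\<beta> < \<kappa>" using that club_subset[OF \<open>club_in \<kappa> T\<close>] by (auto simp: acc_iff)
    then obtain \<alpha> where \<alpha>: "\<alpha> \<in> A" "\<beta> < \<alpha>" using A(2) by blast
    have "\<beta> \<in> acc (T \<inter> {..<\<alpha>})" using acc_initial[of T \<alpha>] that \<alpha>(2) by simp
    then have "\<beta> \<in> acc (D \<alpha>)" by (simp only: T[OF \<alpha>(1)])
    then have "D \<beta> = D \<alpha> \<inter> {..<\<beta>}" using coherent_acc(3)[OF coh] \<alpha>(1) A(1) by blast
    also have "\<dots> = T \<inter> {..<\<alpha>} \<inter> {..<\<beta>}" by (simp only: T[OF \<alpha>(1)])
    also have "\<dots> = T \<inter> {..<\<beta>}" using \<alpha>(2) by auto
    finally show ?thesis by (rule sym)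
  qed
  ultimately show False using sq unfolding square_seq_iff by blast
qed

section \<open>Splitting a stationary set by a square sequence\<close>

definition next_above :: "('o::wellorder \<Rightarrow> 'o set) \<Rightarrow> 'o \<Rightarrow> 'o \<Rightarrow> 'o" where
  "next_above D \<epsilon> \<alpha> = (LEAST \<delta>. \<delta> \<in> D \<alpha> \<and> \<epsilon> < \<delta>)"

lemma next_above:
  assumes "coherent_on \<kappa> D" "\<alpha> \<in> acc {..<\<kappa>}" "\<epsilon> < \<alpha>"
  shows "next_above D \<epsilon> \<alpha> \<in> D \<alpha>" "\<epsilon> < next_above D \<epsilon> \<alpha>" "next_above D \<epsilon> \<alpha> < \<alpha>"
proof -
  have "\<exists>\<delta>. \<delta> \<in> D \<alpha> \<and> \<epsilon> < \<delta>"
    using club_accumulates[OF coherent_club[OF assms(1,2)] assms(2)] assms(3)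
    unfolding accumulates_def by blast
  from LeastI_ex[OF this] show "next_above D \<epsilon> \<alpha> \<in> D \<alpha>" "\<epsilon> < next_above D \<epsilon> \<alpha>"
    by (auto simp: next_above_def)
  then show "next_above D \<epsilon> \<alpha> < \<alpha>" using coherent_subset[OF assms(1,2)] by auto
qed

text \<open>
  This invariance is what makes functions of \<open>next_above D \<epsilon> \<alpha>\<close> usable as index functions of a coherent
  matrix.
\<close>

lemma next_above_coherent:
  assumes "coherent_on \<kappa> D" "\<beta> \<in> acc {..<\<kappa>}" "\<alpha> \<in> acc (D \<beta>)" "\<epsilon> < \<alpha>"
  shows "next_above D \<epsilon> \<alpha> = next_above D \<epsilon> \<beta>"
proof -
  note coh = coherent_acc[OF assms(1-3)]
  note low = next_above[OF assms(1) coh(2) assms(4)]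
  show ?thesis
    unfolding next_above_def[of D \<epsilon> \<beta>]
  proof (rule Least_equality[symmetric])
    show "next_above D \<epsilon> \<alpha> \<in> D \<beta> \<and> \<epsilon> < next_above D \<epsilon> \<alpha>" using low coh(3) by auto
    show "next_above D \<epsilon> \<alpha> \<le> \<delta>" if \<delta>: "\<delta> \<in> D \<beta> \<and> \<epsilon> < \<delta>" for \<delta>
    proof (cases "\<delta> < \<alpha>")
      case True
      then show ?thesis unfolding next_above_def using \<delta> coh(3) by (intro Least_le) auto
    qed (use low in auto)
  qed
qed

context uncountable_regular
begin

lemma stationary_Int_club:
  "stationary_in \<kappa> S \<Longrightarrow> club_in \<kappa> E \<Longrightarrow> stationary_in \<kappa> (S \<inter> E)"
  unfolding stationary_in_def using club_Int by (simp add: Int_assoc le_infI1)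

lemma stationary_mono: "stationary_in \<kappa> S \<Longrightarrow> S \<subseteq> T \<Longrightarrow> T \<subseteq> {..<\<kappa>} \<Longrightarrow> stationary_in \<kappa> T"
  unfolding stationary_in_def by blast

lemma stationary_unbounded:
  assumes "stationary_in \<kappa> S" "\<gamma> < \<kappa>"
  shows "\<exists>\<alpha>\<in>S. \<gamma> < \<alpha>"
proof -
  have "S \<inter> {\<gamma><..<\<kappa>} \<noteq> {}" using assms(1) club_tail[OF assms(2)] unfolding stationary_in_def by blast
  then show ?thesis by auto
qed

lemma club_limits: "club_in \<kappa> (acc {..<\<kappa>})"
proof (rule club_acc)
  show "club_in \<kappa> {..<\<kappa>}" unfolding club_in_iff by blast
qed

text \<open>
  Suppose that for each \<open>\<epsilon>\<close> all values above some \<open>g \<epsilon>\<close> are taken nonstationarily often. Intersecting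
  diagonally the clubs that witness this, over values and over \<open>\<epsilon>\<close>, leaves stationarily many \<open>\<alpha>\<close> with
  \<open>next_above D \<epsilon> \<alpha> \<le> g \<epsilon>\<close> for all \<open>\<epsilon> < \<alpha>\<close>. Between any \<open>\<epsilon>\<close> and a closure point of \<open>g\<close> below such an
  \<open>\<alpha>\<close> there is then an element of \<open>D \<alpha>\<close>, so the closure points of \<open>g\<close> contradict
  \<open>no_coherent_unbounded\<close>.
\<close>

lemma next_above_splits:
  assumes sq: "square_seq \<kappa> D" and S: "stationary_in \<kappa> S"
  shows "\<exists>\<epsilon><\<kappa>. \<forall>\<gamma><\<kappa>. \<exists>\<delta>>\<gamma>. \<delta> < \<kappa> \<and>
    stationary_in \<kappa> {\<alpha> \<in> S \<inter> acc {..<\<kappa>}. \<epsilon> < \<alpha> \<and> next_above D \<epsilon> \<alpha> = \<delta>}"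
proof (rule ccontr)
  define P where "P \<epsilon> \<delta> = {\<alpha> \<in> S \<inter> acc {..<\<kappa>}. \<epsilon> < \<alpha> \<and> next_above D \<epsilon> \<alpha> = \<delta>}" for \<epsilon> \<delta>
  define Q where "Q \<epsilon> \<delta> = stationary_in \<kappa> (P \<epsilon> \<delta>)" for \<epsilon> \<delta>
  assume "\<not> ?thesis"
  then have "\<not> (\<exists>\<epsilon><\<kappa>. \<forall>\<gamma><\<kappa>. \<exists>\<delta>>\<gamma>. \<delta> < \<kappa> \<and> Q \<epsilon> \<delta>)" unfolding Q_def P_def .
  then have "\<exists>\<gamma><\<kappa>. \<forall>\<delta><\<kappa>. \<gamma> < \<delta> \<longrightarrow> \<not> Q \<epsilon> \<delta>" if "\<epsilon> < \<kappa>" for \<epsilon>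
    using that by simp
  then have "\<forall>\<epsilon>. \<exists>\<gamma>. \<epsilon> < \<kappa> \<longrightarrow> \<gamma> < \<kappa> \<and> (\<forall>\<delta><\<kappa>. \<gamma> < \<delta> \<longrightarrow> \<not> Q \<epsilon> \<delta>)"
    by simp
  from choice[OF this] obtain g where g: "\<And>\<epsilon>. \<epsilon> < \<kappa> \<Longrightarrow> g \<epsilon> < \<kappa>"
      and small: "\<And>\<epsilon> \<delta>. \<epsilon> < \<kappa> \<Longrightarrow> g \<epsilon> < \<delta> \<Longrightarrow> \<delta> < \<kappa> \<Longrightarrow> \<not> Q \<epsilon> \<delta>"
    by blast
  have "\<exists>E. club_in \<kappa> E \<and> (g \<epsilon> < \<delta> \<longrightarrow> P \<epsilon> \<delta> \<inter> E = {})" if "\<epsilon> < \<kappa>" "\<delta> < \<kappa>" for \<epsilon> \<delta>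
  proof (cases "g \<epsilon> < \<delta>")
    case True
    have "P \<epsilon> \<delta> \<subseteq> {..<\<kappa>}" unfolding P_def using limitsD(1) by blast
    then show ?thesis
      using small[OF that(1) True that(2)] unfolding Q_def stationary_in_def by blast
  qed (use club_limits in blast)
  then have "\<forall>\<epsilon>. \<exists>E. \<forall>\<delta>. \<epsilon> < \<kappa> \<longrightarrow> \<delta> < \<kappa> \<longrightarrow>
      club_in \<kappa> (E \<delta>) \<and> (g \<epsilon> < \<delta> \<longrightarrow> P \<epsilon> \<delta> \<inter> E \<delta> = {})"
    by (intro allI choice) blast
  from choice[OF this] obtain E where E: "\<And>\<epsilon> \<delta>. \<epsilon> < \<kappa> \<Longrightarrow> \<delta> < \<kappa> \<Longrightarrow> club_in \<kappa> (E \<epsilon> \<delta>)"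
      and avoid: "\<And>\<epsilon> \<delta>. \<epsilon> < \<kappa> \<Longrightarrow> \<delta> < \<kappa> \<Longrightarrow> g \<epsilon> < \<delta> \<Longrightarrow> P \<epsilon> \<delta> \<inter> E \<epsilon> \<delta> = {}"
    by blast
  define F where "F \<epsilon> = {\<alpha>. \<alpha> < \<kappa> \<and> (\<forall>\<delta><\<alpha>. \<alpha> \<in> E \<epsilon> \<delta>)}" for \<epsilon>
  define G where "G = {\<alpha>. \<alpha> < \<kappa> \<and> (\<forall>\<epsilon><\<alpha>. \<alpha> \<in> F \<epsilon>)}"
  \<comment> \<open>the limit closure points of \<open>g\<close>, written as a diagonal intersection\<close>
  define A where "A = acc {..<\<kappa>} \<inter> {\<alpha>. \<alpha> < \<kappa> \<and> (\<forall>\<epsilon><\<alpha>. \<alpha> \<in> {g \<epsilon><..<\<kappa>})}"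
  have "club_in \<kappa> G"
    unfolding G_def F_def by (intro club_diagonal E)
  then have S': "stationary_in \<kappa> (S \<inter> (acc {..<\<kappa>} \<inter> G))"
    by (intro stationary_Int_club S club_Int club_limits)
  have "club_in \<kappa> A"
    unfolding A_def by (intro club_Int club_limits club_diagonal club_tail g)
  have coh: "coherent_on \<kappa> D" using sq by (simp add: square_seq_iff)
  have "\<gamma> \<in> acc (D \<gamma>')" if "\<gamma> \<in> A" "\<gamma>' \<in> A" "\<gamma> < \<gamma>'" for \<gamma> \<gamma>'
  proof -
    have "\<gamma>' < \<kappa>" using that(2) by (simp add: A_def)
    then obtain \<alpha> where \<alpha>: "\<alpha> \<in> S" "\<alpha> \<in> acc {..<\<kappa>}" "\<alpha> \<in> G" "\<gamma>' < \<alpha>"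
      using stationary_unbounded[OF S'] by blast
    note nxt = next_above[OF coh \<alpha>(2)]
    have bound: "next_above D \<epsilon> \<alpha> \<le> g \<epsilon>" if "\<epsilon> < \<alpha>" for \<epsilon>
    proof (rule ccontr)
      assume "\<not> ?thesis"
      moreover have "\<epsilon> < \<kappa>" "next_above D \<epsilon> \<alpha> < \<kappa>"
        using that nxt(3)[OF that] limitsD(1)[OF \<alpha>(2)] by (auto intro: less_trans)
      ultimately have "\<alpha> \<notin> E \<epsilon> (next_above D \<epsilon> \<alpha>)"
        using avoid[of \<epsilon> "next_above D \<epsilon> \<alpha>"] \<alpha>(1,2) that
        unfolding not_le P_def by blast
      moreover have "\<alpha> \<in> E \<epsilon> (next_above D \<epsilon> \<alpha>)"
        using \<alpha>(3) that nxt(3)[OF that] by (simp add: G_def F_def)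
      ultimately show False by blast
    qed
    \<comment> \<open>for \<open>\<epsilon> < \<eta>\<close>, the next element of \<open>D \<alpha>\<close> above \<open>\<epsilon>\<close> is at most \<open>g \<epsilon>\<close>, hence below \<open>\<eta>\<close>\<close>
    have "\<eta> \<in> acc (D \<alpha>)" if "\<eta> \<in> A" "\<eta> < \<alpha>" for \<eta>
    proof -
      have \<eta>: "\<eta> \<in> acc {..<\<kappa>}" "\<forall>\<epsilon><\<eta>. g \<epsilon> < \<eta>" using that(1) by (auto simp: A_def)
      have "accumulates (D \<alpha>) \<eta>"
        unfolding accumulates_def
      proof (intro conjI allI impI)
        show "ord_zero < \<eta>" by (rule limitsD(2)[OF \<eta>(1)])
        fix \<epsilon> assume "\<epsilon> < \<eta>"
        then have "\<epsilon> < \<alpha>" using that(2) by (rule less_trans)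
        moreover have "next_above D \<epsilon> \<alpha> < \<eta>"
          using bound[OF \<open>\<epsilon> < \<alpha>\<close>] \<eta>(2) \<open>\<epsilon> < \<eta>\<close> le_less_trans by blast
        ultimately show "\<exists>\<delta>\<in>D \<alpha>. \<epsilon> < \<delta> \<and> \<delta> < \<eta>" using nxt(1,2) by blast
      qed
      then show ?thesis using club_closed[OF coherent_club[OF coh \<alpha>(2)] that(2)] by (simp add: acc_iff)
    qed
    then have "\<gamma> \<in> acc (D \<alpha>)" "\<gamma>' \<in> acc (D \<alpha>)" using that \<alpha>(4) less_trans by blast+
    then show ?thesis using coherent_acc(4)[OF coh \<alpha>(2)] that(3) by blast
  qed
  moreover have "A \<subseteq> acc {..<\<kappa>}" by (auto simp: A_def)
  ultimately show False
    using no_coherent_unbounded[OF sq] club_above[OF \<open>club_in \<kappa> A\<close>] by blast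
qed

end

section \<open>Trimming and the colouring\<close>

lemma accumulates_remove_initial:
  assumes "\<epsilon> < \<beta>"
  shows "accumulates (A - {..\<epsilon>}) \<beta> \<longleftrightarrow> accumulates A \<beta>"
proof
  assume acc: "accumulates A \<beta>"
  show "accumulates (A - {..\<epsilon>}) \<beta>"
    unfolding accumulates_def
  proof (intro conjI allI impI)
    show "ord_zero < \<beta>" using acc by (simp add: accumulates_def)
    fix \<eta> assume "\<eta> < \<beta>"
    then have "max \<eta> \<epsilon> < \<beta>" using assms by simp
    then obtain \<gamma> where "\<gamma> \<in> A" "max \<eta> \<epsilon> < \<gamma>" "\<gamma> < \<beta>" using acc unfolding accumulates_def by blast
    then show "\<exists>\<gamma>\<in>A - {..\<epsilon>}. \<eta> < \<gamma> \<and> \<gamma> < \<beta>" by (intro bexI[of _ \<gamma>]) auto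
  qed
qed (erule accumulates_mono, blast)

lemma acc_remove_initial: "acc (A - {..\<epsilon>}) = acc A - {..\<epsilon>}"
proof -
  have "\<beta> \<in> acc (A - {..\<epsilon>}) \<longleftrightarrow> \<beta> \<in> acc A - {..\<epsilon>}" for \<beta>
  proof (cases "\<epsilon> < \<beta>")
    case True
    then show ?thesis using accumulates_remove_initial[OF True, of A] by (auto simp: acc_iff)
  next
    case False
    then show ?thesis by (simp add: acc_iff not_less)
  qed
  then show ?thesis by blast
qed

lemma club_remove_initial:
  assumes D: "club_in \<alpha> D" and \<alpha>: "\<alpha> \<in> acc {..<\<kappa>}" and "\<epsilon> < \<alpha>"
  shows "club_in \<alpha> (D - {..\<epsilon>})"
  unfolding club_in_iff
proof (intro conjI allI impI)
  show "D - {..\<epsilon>} \<subseteq> {..<\<alpha>}" using club_subset[OF D] by blast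
  show "\<exists>\<gamma>\<in>D - {..\<epsilon>}. \<beta> \<le> \<gamma>" if "\<beta> < \<alpha>" for \<beta>
  proof -
    have "max \<beta> \<epsilon> < \<alpha>" using that \<open>\<epsilon> < \<alpha>\<close> by simp
    with club_accumulates[OF D \<alpha>] obtain \<gamma> where "\<gamma> \<in> D" "max \<beta> \<epsilon> < \<gamma>" "\<gamma> < \<alpha>"
      unfolding accumulates_def by blast
    then show ?thesis by (intro bexI[of _ \<gamma>]) auto
  qed
  show "\<beta> \<in> D - {..\<epsilon>}" if "\<beta> < \<alpha>" "accumulates (D - {..\<epsilon>}) \<beta>" for \<beta>
  proof -
    from that(2) obtain \<gamma> where "\<gamma> \<in> D - {..\<epsilon>}" "\<gamma> < \<beta>" unfolding accumulates_def by blast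
    then have "\<epsilon> < \<beta>" by auto
    moreover have "accumulates D \<beta>" using that(2) by (rule accumulates_mono) blast
    then have "\<beta> \<in> D" by (rule club_closed[OF D that(1)])
    ultimately show ?thesis by simp
  qed
qed

text \<open>
  Cutting \<open>{..\<epsilon>}\<close> off removes the accumulation points at which \<open>next_above D \<epsilon>\<close> is meaningless. Below \<open>\<epsilon>\<close>
  the whole initial segment serves as a coherent filler.
\<close>

definition trimmed :: "'o::wellorder \<Rightarrow> ('o \<Rightarrow> 'o set) \<Rightarrow> 'o \<Rightarrow> 'o set" where
  "trimmed \<epsilon> D \<alpha> = (if \<epsilon> < \<alpha> then D \<alpha> - {..\<epsilon>} else {..<\<alpha>})"

lemma coherent_trimmed:
  assumes D: "coherent_on \<kappa> D"
  shows "coherent_on \<kappa> (trimmed \<epsilon> D)"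
  unfolding coherent_on_def
proof (intro conjI ballI impI)
  show "club_in \<alpha> (trimmed \<epsilon> D \<alpha>)" if \<alpha>: "\<alpha> \<in> acc {..<\<kappa>}" for \<alpha>
  proof (cases "\<epsilon> < \<alpha>")
    case True
    then show ?thesis
      using club_remove_initial[OF coherent_club[OF D \<alpha>] \<alpha> True] by (simp add: trimmed_def)
  next
    case False
    have "club_in \<alpha> {..<\<alpha>}" unfolding club_in_iff by blast
    then show ?thesis using False by (simp add: trimmed_def)
  qed
  show "trimmed \<epsilon> D \<alpha> = trimmed \<epsilon> D \<beta> \<inter> {..<\<alpha>}"
    if \<beta>: "\<beta> \<in> acc {..<\<kappa>}" and acc: "\<alpha> \<in> acc (trimmed \<epsilon> D \<beta>)" for \<alpha> \<beta>
  proof (cases "\<epsilon> < \<beta>")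
    case True
    with acc have "\<alpha> \<in> acc (D \<beta>) - {..\<epsilon>}"
      by (simp only: trimmed_def if_True acc_remove_initial)
    then have "\<epsilon> < \<alpha>" "\<alpha> \<in> acc (D \<beta>)" by auto
    then have "D \<alpha> - {..\<epsilon>} = (D \<beta> - {..\<epsilon>}) \<inter> {..<\<alpha>}" using coherent_acc(3)[OF D \<beta>] by blast
    then show ?thesis using True \<open>\<epsilon> < \<alpha>\<close> by (simp only: trimmed_def if_True)
  next
    case False
    then have "\<alpha> < \<beta>" using acc by (simp add: trimmed_def acc_iff)
    then have "\<not> \<epsilon> < \<alpha>" "{..<\<alpha>} = {..<\<beta>} \<inter> {..<\<alpha>}" using False by auto
    then show ?thesis using False by (simp only: trimmed_def if_False)
  qed
qed

context uncountable_regular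
begin

text \<open>
  A thread \<open>E\<close> of the trimmed sequence makes the original sequence cohere along \<open>acc E\<close> above \<open>\<epsilon>\<close>.
\<close>

lemma square_seq_trimmed:
  assumes sq: "square_seq \<kappa> D" and "\<epsilon> < \<kappa>"
  shows "square_seq \<kappa> (trimmed \<epsilon> D)"
  unfolding square_seq_iff
proof (intro conjI notI)
  show "coherent_on \<kappa> (trimmed \<epsilon> D)" using sq by (simp add: square_seq_iff coherent_trimmed)
  assume "\<exists>E. club_in \<kappa> E \<and> (\<forall>\<alpha>\<in>acc E. E \<inter> {..<\<alpha>} = trimmed \<epsilon> D \<alpha>)"
  then obtain E where E: "club_in \<kappa> E" "\<And>\<alpha>. \<alpha> \<in> acc E \<Longrightarrow> E \<inter> {..<\<alpha>} = trimmed \<epsilon> D \<alpha>" by blast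
  define A where "A = acc E \<inter> {\<epsilon><..<\<kappa>}"
  have "club_in \<kappa> A" unfolding A_def by (intro club_Int club_acc club_tail E(1) \<open>\<epsilon> < \<kappa>\<close>)
  moreover have "A \<subseteq> acc {..<\<kappa>}" using acc_mono[OF club_subset[OF E(1)]] unfolding A_def by blast
  ultimately obtain \<alpha> \<beta> where \<alpha>\<beta>: "\<alpha> \<in> A" "\<beta> \<in> A" "\<alpha> < \<beta>" "\<alpha> \<notin> acc (D \<beta>)"
    using no_coherent_unbounded[OF sq, of A] club_above by blast
  have "\<alpha> \<in> acc (E \<inter> {..<\<beta>})" using \<alpha>\<beta>(1,3) acc_initial[of E \<beta>] unfolding A_def by simp
  also have "E \<inter> {..<\<beta>} = D \<beta> - {..\<epsilon>}"
    using E(2)[of \<beta>] \<alpha>\<beta>(2) unfolding A_def by (simp add: trimmed_def)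
  finally show False using \<alpha>\<beta>(4) acc_remove_initial[of "D \<beta>" \<epsilon>] by simp
qed

end

text \<open>
  The colour of \<open>\<alpha>\<close> is obtained from \<open>next_above D \<epsilon> \<alpha>\<close> by a map \<open>h\<close> that enumerates \<open>\<mu>\<close> many of the values
  taken stationarily often and sends all other values to zero.
\<close>

lemma coherent_colouring_exists:
  fixes \<kappa> \<mu> :: "'o::wellorder"
  assumes \<kappa>: "infinite_regular_cardinal \<kappa>" "uncountable_regular \<kappa>" and "\<mu> < \<kappa>" "ord_zero < \<mu>"
    and "square \<kappa>" and S: "stationary_in \<kappa> S"
  shows "\<exists>D c. square_seq \<kappa> D \<and> (\<forall>\<alpha>. c \<alpha> < \<mu>) \<and>
    (\<forall>\<alpha>\<in>acc {..<\<kappa>}. \<forall>\<beta>\<in>acc (D \<alpha>). c \<beta> = c \<alpha>) \<and>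
    (\<forall>i<\<mu>. stationary_in \<kappa> {\<alpha> \<in> S \<inter> acc {..<\<kappa>}. c \<alpha> = i})"
proof -
  interpret uncountable_regular \<kappa> by (rule \<kappa>(2))
  obtain D where sq: "square_seq \<kappa> D" using \<open>square \<kappa>\<close> by (auto simp: square_def)
  then have coh: "coherent_on \<kappa> D" by (simp add: square_seq_iff)
  define P where "P \<epsilon> \<delta> = {\<alpha> \<in> S \<inter> acc {..<\<kappa>}. \<epsilon> < \<alpha> \<and> next_above D \<epsilon> \<alpha> = \<delta>}" for \<epsilon> \<delta>
  obtain \<epsilon> where \<epsilon>: "\<epsilon> < \<kappa>" "\<forall>\<gamma><\<kappa>. \<exists>\<delta>>\<gamma>. \<delta> < \<kappa> \<and> stationary_in \<kappa> (P \<epsilon> \<delta>)"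
    using next_above_splits[OF sq S] unfolding P_def by blast
  define K where "K = {\<delta>. \<delta> < \<kappa> \<and> stationary_in \<kappa> (P \<epsilon> \<delta>)}"
  have "K \<subseteq> {..<\<kappa>}" "\<forall>\<gamma><\<kappa>. \<exists>\<delta>\<in>K. \<gamma> < \<delta>" using \<epsilon>(2) unfolding K_def by auto
  from unbounded_contains_copy[OF \<kappa>(1) \<open>\<mu> < \<kappa>\<close> this]
  obtain f where f: "inj_on f {..<\<mu>}" "f ` {..<\<mu>} \<subseteq> K" by blast
  define h where "h \<delta> = (if \<delta> \<in> f ` {..<\<mu>} then inv_into {..<\<mu>} f \<delta> else ord_zero)" for \<delta>
  have h_less: "h \<delta> < \<mu>" for \<delta>
    using inv_into_into[of \<delta> f "{..<\<mu>}"] \<open>ord_zero < \<mu>\<close> by (simp add: h_def)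
  have h_f: "h (f i) = i" if "i < \<mu>" for i using that inv_into_f_f[OF f(1)] by (simp add: h_def)
  define c where "c \<alpha> = (if \<epsilon> < \<alpha> then h (next_above D \<epsilon> \<alpha>) else ord_zero)" for \<alpha>
  have "c \<alpha> < \<mu>" for \<alpha> using h_less \<open>ord_zero < \<mu>\<close> by (simp add: c_def)
  moreover have "c \<beta> = c \<alpha>" if \<alpha>: "\<alpha> \<in> acc {..<\<kappa>}" and \<beta>: "\<beta> \<in> acc (trimmed \<epsilon> D \<alpha>)" for \<alpha> \<beta>
  proof (cases "\<epsilon> < \<alpha>")
    case True
    with \<beta> have "\<beta> \<in> acc (D \<alpha>) - {..\<epsilon>}"
      by (simp only: trimmed_def if_True acc_remove_initial)
    then have "\<epsilon> < \<beta>" "\<beta> \<in> acc (D \<alpha>)" by auto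
    then show ?thesis using True next_above_coherent[OF coh \<alpha>] by (simp add: c_def)
  next
    case False
    then have "\<beta> < \<alpha>" using \<beta> by (simp add: trimmed_def acc_iff)
    then have "\<not> \<epsilon> < \<beta>" using False by auto
    then show ?thesis using False by (simp add: c_def)
  qed
  moreover have "stationary_in \<kappa> {\<alpha> \<in> S \<inter> acc {..<\<kappa>}. c \<alpha> = i}" if i: "i < \<mu>" for i
  proof (rule stationary_mono)
    show "stationary_in \<kappa> (P \<epsilon> (f i))" using f(2) i unfolding K_def by blast
    show "P \<epsilon> (f i) \<subseteq> {\<alpha> \<in> S \<inter> acc {..<\<kappa>}. c \<alpha> = i}" using h_f[OF i] by (auto simp: P_def c_def)
    show "{\<alpha> \<in> S \<inter> acc {..<\<kappa>}. c \<alpha> = i} \<subseteq> {..<\<kappa>}" using limitsD(1) by blast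
  qed
  ultimately show ?thesis using square_seq_trimmed[OF sq \<epsilon>(1)] by blast
qed

section \<open>Ladders\<close>

text \<open>
  A least upper bound outside \<open>A\<close> would be an accumulation point of \<open>A\<close> below \<open>\<alpha>\<close>.
\<close>

lemma closed_has_greatest:
  assumes "A \<noteq> {}" and bd: "\<forall>a\<in>A. a \<le> b" "b < \<alpha>"
    and closed: "\<And>\<beta>. \<beta> < \<alpha> \<Longrightarrow> accumulates A \<beta> \<Longrightarrow> \<beta> \<in> A"
  shows "\<exists>m\<in>A. \<forall>a\<in>A. a \<le> m"
proof -
  define m where "m = (LEAST m. \<forall>a\<in>A. a \<le> m)"
  have up: "\<forall>a\<in>A. a \<le> m" unfolding m_def using bd(1) by (rule LeastI)
  have "m \<le> b" unfolding m_def using bd(1) by (rule Least_le)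
  then have "m < \<alpha>" using bd(2) by (rule le_less_trans)
  have "m \<in> A"
  proof (rule ccontr)
    assume "m \<notin> A"
    then have below: "a < m" if "a \<in> A" for a using up that by (metis le_less)
    obtain a where "a \<in> A" using assms(1) by blast
    then have "ord_zero < m" using below ord_zero_le le_less_trans by blast
    moreover have "\<exists>a\<in>A. \<beta> < a \<and> a < m" if "\<beta> < m" for \<beta>
      using not_less_Least[of \<beta> "\<lambda>m. \<forall>a\<in>A. a \<le> m"] that below unfolding m_def not_le[symmetric] by blast
    ultimately have "accumulates A m" unfolding accumulates_def by blast
    then show False using closed \<open>m < \<alpha>\<close> \<open>m \<notin> A\<close> by blast
  qed
  then show ?thesis using up by blast
qed

text \<open>
  At each stage of the induction, the failure of accumulation at \<open>\<xi>\<close> leaves at most one element of \<open>Y\<close> beyond an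
  initial part that is finite by the induction hypothesis.
\<close>

lemma finite_if_no_accumulation:
  assumes "\<And>\<beta>. \<beta> \<le> \<xi> \<Longrightarrow> \<not> accumulates Y \<beta>"
  shows "finite {y \<in> Y. y < \<xi>}"
  using assms
proof (induction \<xi> rule: less_induct)
  case (less \<xi>)
  show ?case
  proof (cases "ord_zero < \<xi>")
    case True
    then obtain \<eta> where \<eta>: "\<eta> < \<xi>" "\<forall>y\<in>Y. \<not> (\<eta> < y \<and> y < \<xi>)"
      using less.prems[of \<xi>] unfolding accumulates_def by blast
    have "\<not> accumulates Y \<beta>" if "\<beta> \<le> \<eta>" for \<beta>
      using less.prems[of \<beta>] that \<eta>(1) by simp
    then have "finite {y \<in> Y. y < \<eta>}" by (intro less.IH \<eta>(1))
    moreover have "{y \<in> Y. y < \<xi>} \<subseteq> insert \<eta> {y \<in> Y. y < \<eta>}" using \<eta>(2) by auto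
    ultimately show ?thesis by (meson finite.insertI finite_subset)
  next
    case False
    then have "{y \<in> Y. y < \<xi>} = {}" using ord_zero_le le_less_trans by blast
    then show ?thesis by (simp only: finite.emptyI)
  qed
qed

lemma finite_common_index:
  fixes P :: "'a \<Rightarrow> 'i::linorder \<Rightarrow> bool"
  assumes "finite R" and "\<And>x. x \<in> R \<Longrightarrow> \<exists>i. i < m \<and> P x i" and "k < m"
    and mono: "\<And>x i j. x \<in> R \<Longrightarrow> P x i \<Longrightarrow> i \<le> j \<Longrightarrow> j < m \<Longrightarrow> P x j"
  shows "\<exists>i. k \<le> i \<and> i < m \<and> (\<forall>x\<in>R. P x i)"
  using assms
proof (induction R rule: finite_induct)
  case empty
  then show ?case by blast
next
  case (insert x R)
  from insert.prems obtain i where i: "k \<le> i" "i < m" "\<forall>x\<in>R. P x i"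
    using insert.IH by (metis insertCI)
  obtain j where j: "j < m" "P x j" using insert.prems(1)[of x] by blast
  have "P y (max i j)" if "y \<in> insert x R" for y
    using that insert.prems(3) i j by (metis insert_iff max.cobounded1 max.cobounded2 max_less_iff_conj)
  then show ?case using i j by (intro exI[of _ "max i j"]) (auto simp: le_max_iff_disj)
qed

text \<open>
  The role of the clauses for \<open>A = acc (D \<alpha>)\<close>: the ladder starts with \<open>A\<close> and continues discretely, so it
  adds no accumulation points beyond those of \<open>A\<close>; its limit members precede all others, since a
  successor ordinal below a limit \<open>\<xi>\<close> could never become an accumulation point of the club attached to \<open>\<xi>\<close>; and
  its limit members are cofinal among the limits below \<open>\<alpha>\<close>, which lets them reach every smaller limit.
\<close>

definition ladder :: "'o::wellorder \<Rightarrow> 'o set \<Rightarrow> 'o set \<Rightarrow> bool" where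
  "ladder \<alpha> A X \<longleftrightarrow>
     X \<subseteq> {..<\<alpha>} \<and> (\<forall>\<beta><\<alpha>. \<exists>\<xi>\<in>X. \<beta> < \<xi>) \<and>
     A \<subseteq> X \<and> (\<forall>\<xi>\<in>A. \<forall>\<eta>\<in>X. \<eta> < \<xi> \<longrightarrow> \<eta> \<in> A) \<and>
     (\<forall>\<xi>\<in>X \<inter> acc {..<\<alpha>}. \<forall>\<eta>\<in>X. \<eta> < \<xi> \<longrightarrow> \<eta> \<in> acc {..<\<alpha>}) \<and>
     (\<forall>\<beta>\<in>acc {..<\<alpha>}. \<exists>\<xi>\<in>X \<inter> acc {..<\<alpha>}. \<beta> \<le> \<xi>) \<and>
     (\<forall>\<xi><\<alpha>. finite {\<eta> \<in> X. \<eta> < \<xi> \<and> \<eta> \<notin> A})"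

lemma ladderD:
  assumes "ladder \<alpha> A X"
  shows "X \<subseteq> {..<\<alpha>}" "\<And>\<beta>. \<beta> < \<alpha> \<Longrightarrow> \<exists>\<xi>\<in>X. \<beta> < \<xi>" "A \<subseteq> X"
    "\<And>\<xi> \<eta>. \<xi> \<in> A \<Longrightarrow> \<eta> \<in> X \<Longrightarrow> \<eta> < \<xi> \<Longrightarrow> \<eta> \<in> A"
    "\<And>\<xi> \<eta>. \<xi> \<in> X \<Longrightarrow> \<xi> \<in> acc {..<\<alpha>} \<Longrightarrow> \<eta> \<in> X \<Longrightarrow> \<eta> < \<xi> \<Longrightarrow> \<eta> \<in> acc {..<\<alpha>}"
    "\<And>\<beta>. \<beta> \<in> acc {..<\<alpha>} \<Longrightarrow> \<exists>\<xi>\<in>X \<inter> acc {..<\<alpha>}. \<beta> \<le> \<xi>"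
    "\<And>\<xi>. \<xi> < \<alpha> \<Longrightarrow> finite {\<eta> \<in> X. \<eta> < \<xi> \<and> \<eta> \<notin> A}"
  using assms unfolding ladder_def by blast+

lemma ladderI:
  assumes "X \<subseteq> {..<\<alpha>}" "\<And>\<beta>. \<beta> < \<alpha> \<Longrightarrow> \<exists>\<xi>\<in>X. \<beta> < \<xi>" "A \<subseteq> X"
    "\<And>\<xi> \<eta>. \<xi> \<in> A \<Longrightarrow> \<eta> \<in> X \<Longrightarrow> \<eta> < \<xi> \<Longrightarrow> \<eta> \<in> A"
    "\<And>\<xi> \<eta>. \<xi> \<in> X \<Longrightarrow> \<xi> \<in> acc {..<\<alpha>} \<Longrightarrow> \<eta> \<in> X \<Longrightarrow> \<eta> < \<xi> \<Longrightarrow> \<eta> \<in> acc {..<\<alpha>}"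
    "\<And>\<beta>. \<beta> \<in> acc {..<\<alpha>} \<Longrightarrow> \<exists>\<xi>\<in>X \<inter> acc {..<\<alpha>}. \<beta> \<le> \<xi>"
    "\<And>\<xi>. \<xi> < \<alpha> \<Longrightarrow> finite {\<eta> \<in> X. \<eta> < \<xi> \<and> \<eta> \<notin> A}"
  shows "ladder \<alpha> A X"
  unfolding ladder_def
proof (intro conjI ballI allI impI)
  show "\<eta> \<in> A" if "\<xi> \<in> A" "\<eta> \<in> X" "\<eta> < \<xi>" for \<xi> \<eta> using that by (rule assms(4))
  show "\<eta> \<in> acc {..<\<alpha>}" if "\<xi> \<in> X \<inter> acc {..<\<alpha>}" "\<eta> \<in> X" "\<eta> < \<xi>" for \<xi> \<eta>
    using assms(5) that by blast
qed (fact assms | rule assms, assumption)+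

text \<open>
  If \<open>acc E\<close> is bounded in \<open>\<alpha>\<close>, the part \<open>Y\<close> of \<open>E\<close> beyond it is cofinal with finite initial
  segments. When limits are cofinal in \<open>\<alpha>\<close>, each element of \<open>Y\<close> is rounded up to a limit. Otherwise the
  largest limit below \<open>\<alpha>\<close> is put in front of the elements of \<open>Y\<close> above it.
\<close>

lemma ladder_exists:
  fixes \<alpha> :: "'o::wellorder"
  assumes \<alpha>: "\<alpha> \<in> acc {..<\<kappa>}" and E: "club_in \<alpha> E"
  shows "\<exists>X. ladder \<alpha> (acc E) X"
proof (cases "\<forall>\<beta><\<alpha>. \<exists>\<xi>\<in>acc E. \<beta> < \<xi>")
  case True
  have limits: "acc E \<subseteq> acc {..<\<alpha>}" using acc_mono club_subset[OF E] by blast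
  have "ladder \<alpha> (acc E) (acc E)"
  proof (rule ladderI)
    show "acc E \<subseteq> {..<\<alpha>}" using club_subset[OF E] by (auto simp: acc_iff)
    show "\<exists>\<xi>\<in>acc E \<inter> acc {..<\<alpha>}. \<beta> \<le> \<xi>" if "\<beta> \<in> acc {..<\<alpha>}" for \<beta>
      using True limitsD(1)[OF that] limits less_imp_le by blast
    show "finite {\<eta> \<in> acc E. \<eta> < \<xi> \<and> \<eta> \<notin> acc E}" for \<xi>
    proof -
      have "{\<eta> \<in> acc E. \<eta> < \<xi> \<and> \<eta> \<notin> acc E} = {}" by blast
      then show ?thesis by (simp only: finite.emptyI)
    qed
  qed (use True limits in blast)+
  then show ?thesis ..
next
  case False
  define L where "L = acc {..<\<alpha>}"
  have L: "L \<subseteq> {..<\<alpha>}" unfolding L_def using limitsD(1) by blast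
  have accL: "acc E \<subseteq> L" unfolding L_def using acc_mono club_subset[OF E] by blast
  obtain b where b: "b < \<alpha>" "\<And>\<xi>. \<xi> \<in> acc E \<Longrightarrow> \<xi> \<le> b" using False not_le by blast
  define Y where "Y = {y \<in> E. b < y}"
  have Y: "\<exists>y\<in>Y. \<beta> < y" if "\<beta> < \<alpha>" for \<beta>
  proof -
    have "max \<beta> b < \<alpha>" using that b(1) by simp
    then show ?thesis
      using club_accumulates[OF E \<alpha>] unfolding accumulates_def Y_def by fastforce
  qed
  have Y\<alpha>: "Y \<subseteq> {..<\<alpha>}" using club_subset[OF E] by (auto simp: Y_def)
  have finite: "finite {y \<in> Y. y < \<xi>}" if \<xi>: "\<xi> < \<alpha>" for \<xi>
  proof (rule finite_if_no_accumulation, rule notI)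
    fix \<beta> assume "\<beta> \<le> \<xi>" and acc: "accumulates Y \<beta>"
    have "Y \<subseteq> E" by (auto simp: Y_def)
    then have "\<beta> \<in> acc E"
      using club_closed[OF E le_less_trans[OF \<open>\<beta> \<le> \<xi>\<close> \<xi>]] accumulates_mono[OF acc]
      by (simp add: acc_iff)
    then have "\<beta> \<le> b" by (rule b(2))
    moreover obtain y where "y \<in> Y" "y < \<beta>" using acc unfolding accumulates_def by blast
    ultimately show False unfolding Y_def by fastforce
  qed
  show ?thesis
  proof (cases "\<forall>\<beta><\<alpha>. \<exists>l\<in>L. \<beta> < l")
    case True
    define n where "n y = (LEAST l. l \<in> L \<and> y \<le> l)" for y
    have n: "n y \<in> L \<and> y \<le> n y" if "y \<in> Y" for y
    proof -
      have "\<exists>l. l \<in> L \<and> y \<le> l" using True Y\<alpha> that less_imp_le by blast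
      then show ?thesis unfolding n_def by (rule LeastI_ex)
    qed
    define X where "X = acc E \<union> n ` Y"
    have XL: "X \<subseteq> L" using accL n unfolding X_def by blast
    have cof: "\<exists>\<xi>\<in>X. \<beta> < \<xi>" if \<beta>: "\<beta> < \<alpha>" for \<beta>
    proof -
      obtain y where "y \<in> Y" "\<beta> < y" using Y[OF \<beta>] by blast
      then show ?thesis using n[of y] less_le_trans unfolding X_def by blast
    qed
    have init: "\<eta> \<in> acc E" if \<xi>: "\<xi> \<in> acc E" and \<eta>: "\<eta> \<in> X" "\<eta> < \<xi>" for \<xi> \<eta>
    proof (rule ccontr)
      assume "\<eta> \<notin> acc E"
      then obtain y where "y \<in> Y" "\<eta> = n y" using \<eta>(1) unfolding X_def by blast
      then have "b < \<eta>" using n[of y] unfolding Y_def by auto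
      then show False using b(2)[OF \<xi>] \<eta>(2) by simp
    qed
    have fin: "finite {\<eta> \<in> X. \<eta> < \<xi> \<and> \<eta> \<notin> acc E}" if \<xi>: "\<xi> < \<alpha>" for \<xi>
    proof (rule finite_subset)
      show "{\<eta> \<in> X. \<eta> < \<xi> \<and> \<eta> \<notin> acc E} \<subseteq> n ` {y \<in> Y. y < \<xi>}"
        using n le_less_trans unfolding X_def by fastforce
    qed (use finite[OF \<xi>] in simp)
    have "ladder \<alpha> (acc E) X"
    proof (rule ladderI, unfold L_def[symmetric])
      show "X \<subseteq> {..<\<alpha>}" using XL L by blast
      show "acc E \<subseteq> X" unfolding X_def by blast
      show "\<exists>\<xi>\<in>X \<inter> L. \<beta> \<le> \<xi>" if "\<beta> \<in> L" for \<beta>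
        using cof[of \<beta>] that L XL less_imp_le by blast
      show "\<eta> \<in> L" if "\<eta> \<in> X" for \<eta> using that XL by blast
    qed (use cof init fin in \<open>blast\<close>)+
    then show ?thesis ..
  next
    case False
    then obtain b' where b': "b' < \<alpha>" "\<forall>l\<in>L. l \<le> b'" using not_le by blast
    define M where "M = {l \<in> L. \<forall>l'\<in>L. l' \<le> l}"
    have M: "\<exists>m\<in>M. \<forall>l\<in>L. l \<le> m" if "L \<noteq> {}"
    proof -
      have "\<beta> \<in> L" if "\<beta> < \<alpha>" "accumulates L \<beta>" for \<beta>
        using limitsI that unfolding L_def by blast
      from closed_has_greatest[OF \<open>L \<noteq> {}\<close> b'(2,1) this] show ?thesis unfolding M_def by blast
    qed
    define X where "X = acc E \<union> M \<union> {y \<in> Y. \<forall>l\<in>L. l < y}"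
    have cof: "\<exists>\<xi>\<in>X. \<beta> < \<xi>" if \<beta>: "\<beta> < \<alpha>" for \<beta>
    proof -
      have "max \<beta> b' < \<alpha>" using \<beta> b'(1) by simp
      then obtain y where "y \<in> Y" "max \<beta> b' < y" using Y by blast
      then show ?thesis using b'(2) unfolding X_def by (intro bexI[of _ y]) auto
    qed
    have init: "\<eta> \<in> acc E" if \<xi>: "\<xi> \<in> acc E" and \<eta>: "\<eta> \<in> X" "\<eta> < \<xi>" for \<xi> \<eta>
    proof (rule ccontr)
      assume "\<eta> \<notin> acc E"
      then have "(\<forall>l\<in>L. l \<le> \<eta>) \<or> b < \<eta>" using \<eta>(1) unfolding X_def M_def Y_def by blast
      then have "\<xi> \<le> \<eta> \<or> b < \<eta>" using \<xi> accL by blast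
      then show False using b(2)[OF \<xi>] \<eta>(2) by auto
    qed
    have fin: "finite {\<eta> \<in> X. \<eta> < \<xi> \<and> \<eta> \<notin> acc E}" if \<xi>: "\<xi> < \<alpha>" for \<xi>
    proof (rule finite_subset)
      show "{\<eta> \<in> X. \<eta> < \<xi> \<and> \<eta> \<notin> acc E} \<subseteq> M \<union> {y \<in> Y. y < \<xi>}" unfolding X_def by blast
      have "M \<subseteq> {m}" if "m \<in> M" for m using that unfolding M_def by (auto intro: antisym)
      then have "finite M" by (metis finite.emptyI finite_insert finite_subset all_not_in_conv)
      then show "finite (M \<union> {y \<in> Y. y < \<xi>})" using finite[OF \<xi>] by simp
    qed
    have lim: "\<eta> \<in> L" if "\<xi> \<in> X" "\<xi> \<in> L" "\<eta> \<in> X" "\<eta> < \<xi>" for \<xi> \<eta>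
    proof (rule ccontr)
      assume "\<eta> \<notin> L"
      then have "\<xi> < \<eta>" using that(2,3) accL unfolding X_def M_def by blast
      then show False using that(4) by simp
    qed
    have "ladder \<alpha> (acc E) X"
    proof (rule ladderI, unfold L_def[symmetric])
      show "X \<subseteq> {..<\<alpha>}" using L accL Y\<alpha> unfolding X_def M_def by blast
      show "\<exists>\<xi>\<in>X \<inter> L. \<beta> \<le> \<xi>" if "\<beta> \<in> L" for \<beta>
        using M that unfolding X_def M_def by blast
      show "acc E \<subseteq> X" unfolding X_def by blast
    qed (use cof init fin lim in blast)+
    then show ?thesis ..
  qed
qed

section \<open>The matrix\<close>

text \<open>
  The entry of row \<open>\<alpha>\<close> and column \<open>i\<close> is \<open>matrix X c i \<alpha>\<close>; the recursion runs along \<open>\<alpha>\<close> within one column.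
\<close>

definition matrix :: "('o::wellorder \<Rightarrow> 'o set) \<Rightarrow> ('o \<Rightarrow> 'o) \<Rightarrow> 'o \<Rightarrow> 'o \<Rightarrow> 'o set" where
  "matrix X c i = wfrec {(\<xi>, \<alpha>). \<xi> < \<alpha>} (\<lambda>C \<alpha>.
     X \<alpha> \<union> (\<Union>\<xi>\<in>{\<xi> \<in> X \<alpha> \<inter> acc {..<\<alpha>}. c \<xi> \<le> i \<and> X \<alpha> \<inter> {..<\<xi>} \<subseteq> acc (C \<xi>)}. C \<xi>))"

text \<open>
  The ladder points whose own entry in column \<open>i\<close> becomes part of the entry of \<open>\<alpha>\<close>.
\<close>

definition absorbed :: "('o::wellorder \<Rightarrow> 'o set) \<Rightarrow> ('o \<Rightarrow> 'o) \<Rightarrow> 'o \<Rightarrow> 'o \<Rightarrow> 'o set" where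
  "absorbed X c i \<alpha> =
     {\<xi> \<in> X \<alpha> \<inter> acc {..<\<alpha>}. c \<xi> \<le> i \<and> X \<alpha> \<inter> {..<\<xi>} \<subseteq> acc (matrix X c i \<xi>)}"

lemma matrix_unfold: "matrix X c i \<alpha> = X \<alpha> \<union> (\<Union>\<xi>\<in>absorbed X c i \<alpha>. matrix X c i \<xi>)"
proof -
  define F where "F C \<alpha> =
     X \<alpha> \<union> (\<Union>\<xi>\<in>{\<xi> \<in> X \<alpha> \<inter> acc {..<\<alpha>}. c \<xi> \<le> i \<and> X \<alpha> \<inter> {..<\<xi>} \<subseteq> acc (C \<xi>)}. C \<xi>)" for C \<alpha>
  have "adm_wf {(\<xi>, \<alpha>). \<xi> < \<alpha>} F"
    unfolding adm_wf_def
  proof (intro allI impI)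
    fix f g :: "'a \<Rightarrow> 'a set" and \<alpha>
    assume "\<forall>\<xi>. (\<xi>, \<alpha>) \<in> {(\<xi>, \<alpha>). \<xi> < \<alpha>} \<longrightarrow> f \<xi> = g \<xi>"
    then have "f \<xi> = g \<xi>" if "\<xi> \<in> acc {..<\<alpha>}" for \<xi> using limitsD(1)[OF that] by simp
    then show "F f \<alpha> = F g \<alpha>" unfolding F_def by (auto 0 3)
  qed
  moreover have "wf {(\<xi>, \<alpha>). \<xi> < (\<alpha>::'a)}" by (rule wf)
  ultimately have "wfrec {(\<xi>, \<alpha>). \<xi> < \<alpha>} F = F (wfrec {(\<xi>, \<alpha>). \<xi> < \<alpha>} F)"
    by (intro wfrec_fixpoint)
  moreover have "matrix X c i = wfrec {(\<xi>, \<alpha>). \<xi> < \<alpha>} F" unfolding matrix_def F_def ..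
  ultimately have "matrix X c i = F (matrix X c i)" by simp
  then have "matrix X c i \<alpha> = F (matrix X c i) \<alpha>" by (rule fun_cong)
  then show ?thesis unfolding F_def absorbed_def .
qed

lemma absorbed_mono:
  assumes "i \<le> j" and "\<And>\<xi>. \<xi> \<in> acc {..<\<alpha>} \<Longrightarrow> matrix X c i \<xi> \<subseteq> matrix X c j \<xi>"
  shows "absorbed X c i \<alpha> \<subseteq> absorbed X c j \<alpha>"
  using acc_mono[OF assms(2)] assms(1) unfolding absorbed_def by (blast intro: order_trans)

text \<open>
  Enlarging \<open>i\<close> enlarges the entries of smaller rows, hence their accumulation points, and so absorbs more
  ladder points.
\<close>

lemma matrix_mono: "i \<le> j \<Longrightarrow> matrix X c i \<alpha> \<subseteq> matrix X c j \<alpha>"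
proof (induction \<alpha> rule: less_induct)
  case (less \<alpha>)
  have IH: "matrix X c i \<xi> \<subseteq> matrix X c j \<xi>" if "\<xi> \<in> acc {..<\<alpha>}" for \<xi>
    using less limitsD(1)[OF that] by blast
  have "matrix X c i \<xi> \<subseteq> matrix X c j \<alpha>" if "\<xi> \<in> absorbed X c i \<alpha>" for \<xi>
  proof -
    have "\<xi> \<in> acc {..<\<alpha>}" using that unfolding absorbed_def by blast
    moreover have "\<xi> \<in> absorbed X c j \<alpha>" using absorbed_mono[OF less.prems IH] that by blast
    ultimately show ?thesis using IH matrix_unfold[of X c j \<alpha>] by blast
  qed
  then show ?case using matrix_unfold[of X c i \<alpha>] matrix_unfold[of X c j \<alpha>] by blast
qed

locale coloured_ladders =
  fixes \<kappa> :: "'o::wellorder" and D X :: "'o \<Rightarrow> 'o set" and c :: "'o \<Rightarrow> 'o"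
  assumes coherent: "coherent_on \<kappa> D"
    and ladder: "\<And>\<alpha>. \<alpha> \<in> acc {..<\<kappa>} \<Longrightarrow> ladder \<alpha> (acc (D \<alpha>)) (X \<alpha>)"
    and colour: "\<And>\<alpha> \<beta>. \<alpha> \<in> acc {..<\<kappa>} \<Longrightarrow> \<beta> \<in> acc (D \<alpha>) \<Longrightarrow> c \<beta> = c \<alpha>"
begin

abbreviation C where "C \<alpha> i \<equiv> matrix X c i \<alpha>"
abbreviation G where "G \<alpha> i \<equiv> absorbed X c i \<alpha>"

text \<open>
  The invariant of the recursion along \<open>\<alpha>\<close>. The last clause is what allows all of \<open>acc (D \<alpha>)\<close> to be absorbed
  in every column.
\<close>

definition coherent_at :: "'o \<Rightarrow> 'o \<Rightarrow> bool" where
  "coherent_at i \<alpha> \<longleftrightarrow> club_in \<alpha> (C \<alpha> i) \<and>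
     (\<forall>\<beta>\<in>acc (C \<alpha> i). c \<beta> \<le> i \<and> C \<beta> i = C \<alpha> i \<inter> {..<\<beta>}) \<and> acc (D \<alpha>) \<subseteq> acc (C \<alpha> i)"

lemma coherent_atD:
  assumes "coherent_at i \<alpha>"
  shows "club_in \<alpha> (C \<alpha> i)" "C \<alpha> i \<subseteq> {..<\<alpha>}" "acc (D \<alpha>) \<subseteq> acc (C \<alpha> i)"
    "\<And>\<beta>. \<beta> \<in> acc (C \<alpha> i) \<Longrightarrow> c \<beta> \<le> i"
    "\<And>\<beta>. \<beta> \<in> acc (C \<alpha> i) \<Longrightarrow> C \<beta> i = C \<alpha> i \<inter> {..<\<beta>}"
  using assms club_subset unfolding coherent_at_def by blast+

lemma limit_below: "\<alpha> \<in> acc {..<\<kappa>} \<Longrightarrow> \<xi> \<in> acc {..<\<alpha>} \<Longrightarrow> \<xi> \<in> acc {..<\<kappa>}"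
  using limits_initial[of \<alpha> \<kappa>] limitsD(1)[of \<alpha> \<kappa>] by auto

context
  fixes \<alpha> i
  assumes \<alpha>: "\<alpha> \<in> acc {..<\<kappa>}" and i: "c \<alpha> \<le> i"
    and IH: "\<And>\<xi>. \<xi> < \<alpha> \<Longrightarrow> \<xi> \<in> acc {..<\<kappa>} \<Longrightarrow> c \<xi> \<le> i \<Longrightarrow> coherent_at i \<xi>"
begin

lemma absorbedD:
  assumes "\<xi> \<in> G \<alpha> i"
  shows "\<xi> \<in> X \<alpha>" "\<xi> \<in> acc {..<\<alpha>}" "\<xi> < \<alpha>" "\<xi> \<in> acc {..<\<kappa>}" "c \<xi> \<le> i" "coherent_at i \<xi>"
    "X \<alpha> \<inter> {..<\<xi>} \<subseteq> acc (C \<xi> i)" "C \<xi> i \<subseteq> C \<alpha> i"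
proof -
  show *: "\<xi> \<in> X \<alpha>" "\<xi> \<in> acc {..<\<alpha>}" "c \<xi> \<le> i" "X \<alpha> \<inter> {..<\<xi>} \<subseteq> acc (C \<xi> i)"
    using assms unfolding absorbed_def by auto
  show **: "\<xi> < \<alpha>" "\<xi> \<in> acc {..<\<kappa>}" using limitsD(1)[OF *(2)] limit_below[OF \<alpha> *(2)] by auto
  show "coherent_at i \<xi>" by (rule IH[OF ** *(3)])
  show "C \<xi> i \<subseteq> C \<alpha> i" using assms matrix_unfold[of X c i \<alpha>] by blast
qed

text \<open>
  Of two absorbed ladder points, the smaller is an accumulation point of the entry of the larger, so their
  entries end-extend each other.
\<close>

lemma absorbed_initial:
  assumes \<xi>: "\<xi> \<in> G \<alpha> i"
  shows "C \<alpha> i \<inter> {..<\<xi>} = C \<xi> i"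
proof
  note \<xi>D = absorbedD[OF \<xi>]
  show "C \<xi> i \<subseteq> C \<alpha> i \<inter> {..<\<xi>}" using \<xi>D(8) coherent_atD(2)[OF \<xi>D(6)] by blast
  have "C \<eta> i \<inter> {..<\<xi>} \<subseteq> C \<xi> i" if \<eta>: "\<eta> \<in> G \<alpha> i" for \<eta>
  proof (cases \<eta> \<xi> rule: linorder_cases)
    case less
    then have "\<eta> \<in> acc (C \<xi> i)" using \<xi>D(7) absorbedD(1)[OF \<eta>] by blast
    then show ?thesis using coherent_atD(5)[OF \<xi>D(6)] by blast
  next
    case greater
    then have "\<xi> \<in> acc (C \<eta> i)" using absorbedD(7)[OF \<eta>] \<xi>D(1) by blast
    then show ?thesis using coherent_atD(5)[OF absorbedD(6)[OF \<eta>]] by blast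
  qed auto
  moreover have "X \<alpha> \<inter> {..<\<xi>} \<subseteq> C \<xi> i" using \<xi>D(7) by (auto simp: acc_iff)
  ultimately show "C \<alpha> i \<inter> {..<\<xi>} \<subseteq> C \<xi> i" using matrix_unfold[of X c i \<alpha>] by blast
qed

lemma absorbed_acc: "\<xi> \<in> G \<alpha> i \<Longrightarrow> \<xi> \<in> acc (C \<alpha> i)"
proof -
  assume \<xi>: "\<xi> \<in> G \<alpha> i"
  note \<xi>D = absorbedD[OF \<xi>]
  have "accumulates (C \<alpha> i) \<xi>"
    using club_accumulates[OF coherent_atD(1)[OF \<xi>D(6)] \<xi>D(4)] \<xi>D(8) by (rule accumulates_mono)
  then show ?thesis using \<xi>D(1) matrix_unfold[of X c i \<alpha>] by (auto simp: acc_iff)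
qed

text \<open>
  Below \<open>\<xi> \<in> acc (D \<alpha>)\<close> the ladder of \<open>\<alpha>\<close> is just \<open>acc (D \<xi>)\<close>, and \<open>\<xi>\<close> has the colour of \<open>\<alpha>\<close>.
\<close>

lemma acc_absorbed: "acc (D \<alpha>) \<subseteq> G \<alpha> i"
proof
  fix \<xi> assume \<xi>: "\<xi> \<in> acc (D \<alpha>)"
  note coh = coherent_acc[OF coherent \<alpha> \<xi>]
  have "c \<xi> \<le> i" using colour[OF \<alpha> \<xi>] i by simp
  then have "acc (D \<xi>) \<subseteq> acc (C \<xi> i)" by (intro coherent_atD(3) IH coh(1,2))
  moreover have "X \<alpha> \<inter> {..<\<xi>} \<subseteq> acc (D \<xi>)" using ladderD(4)[OF ladder[OF \<alpha>] \<xi>] coh(4) by blast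
  moreover have "\<xi> \<in> acc {..<\<alpha>}" using acc_mono[OF coherent_subset[OF coherent \<alpha>]] \<xi> by blast
  moreover have "\<xi> \<in> X \<alpha>" using ladderD(3)[OF ladder[OF \<alpha>]] \<xi> by blast
  ultimately show "\<xi> \<in> G \<alpha> i" using \<open>c \<xi> \<le> i\<close> unfolding absorbed_def by blast
qed

text \<open>
  Above all absorbed points, the entry of \<open>\<alpha>\<close> consists of ladder points only; those below a given \<open>\<beta> < \<alpha>\<close> are
  members of \<open>acc (D \<alpha>)\<close>, which is closed in \<open>\<alpha>\<close>, and finitely many others. Hence they cannot be
  cofinal in \<open>\<beta>\<close> unless some absorbed point reaches \<open>\<beta>\<close>.
\<close>

lemma accumulates_below_absorbed:
  assumes "\<beta> < \<alpha>" "accumulates (C \<alpha> i) \<beta>"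
  shows "\<exists>\<xi>\<in>G \<alpha> i. \<beta> \<le> \<xi>"
proof (rule ccontr)
  assume "\<not> ?thesis"
  then have G: "\<xi> < \<beta>" if "\<xi> \<in> G \<alpha> i" for \<xi> using that not_le by blast
  \<comment> \<open>all of \<open>acc (D \<alpha>)\<close> is absorbed, hence lies below \<open>\<beta>\<close>, and \<open>D \<alpha>\<close> is closed\<close>
  have "\<not> accumulates (acc (D \<alpha>)) \<beta>"
  proof
    assume "accumulates (acc (D \<alpha>)) \<beta>"
    then have "accumulates (D \<alpha>) \<beta>" by (rule accumulates_mono) (auto simp: acc_iff)
    then have "\<beta> \<in> acc (D \<alpha>)"
      using club_closed[OF coherent_club[OF coherent \<alpha>] assms(1)] by (simp add: acc_iff)
    then show False using acc_absorbed G by blast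
  qed
  moreover have "ord_zero < \<beta>" using assms(2) by (simp add: accumulates_def)
  ultimately obtain \<eta> where "\<eta> < \<beta>" and gap: "\<forall>\<xi>\<in>acc (D \<alpha>). \<not> (\<eta> < \<xi> \<and> \<xi> < \<beta>)"
    unfolding accumulates_def by blast
  have "\<xi> \<le> \<eta>" if "\<xi> \<in> acc (D \<alpha>)" for \<xi>
  proof -
    have "\<xi> < \<beta>" using acc_absorbed that G by blast
    then have "\<not> \<eta> < \<xi>" using gap that by blast
    then show ?thesis by (simp only: not_less)
  qed
  note \<eta> = \<open>\<eta> < \<beta>\<close> this
  define F where "F = insert \<eta> {\<xi> \<in> X \<alpha>. \<xi> < \<beta> \<and> \<xi> \<notin> acc (D \<alpha>)}"
  have F: "finite F" "F \<noteq> {}" using ladderD(7)[OF ladder[OF \<alpha>] assms(1)] by (auto simp: F_def)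
  have "\<xi> < \<beta>" if "\<xi> \<in> F" for \<xi> using that \<eta>(1) by (auto simp: F_def)
  then have "Max F < \<beta>" using Max_in[OF F] by blast
  have X: "\<xi> \<le> Max F" if "\<xi> \<in> X \<alpha>" "\<xi> < \<beta>" for \<xi>
  proof (cases "\<xi> \<in> acc (D \<alpha>)")
    case True
    have "\<eta> \<le> Max F" using F(1) by (rule Max_ge) (simp add: F_def)
    with \<eta>(2)[OF True] show ?thesis by (rule order_trans)
  next
    case False
    then show ?thesis using that by (intro Max_ge F) (simp add: F_def)
  qed
  obtain x where x: "x \<in> C \<alpha> i" "Max F < x" "x < \<beta>"
    using assms(2) \<open>Max F < \<beta>\<close> unfolding accumulates_def by blast
  have "x \<notin> X \<alpha>" using X[of x] x(2,3) by fastforce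
  then obtain \<xi> where \<xi>: "\<xi> \<in> G \<alpha> i" "x \<in> C \<xi> i" using x(1) matrix_unfold[of X c i \<alpha>] by blast
  then have "x < \<xi>" using coherent_atD(2)[OF absorbedD(6)[OF \<xi>(1)]] by blast
  moreover have "\<xi> \<le> Max F" using X absorbedD(1)[OF \<xi>(1)] G[OF \<xi>(1)] by blast
  ultimately show False using x(2) by simp
qed

text \<open>
  By \<open>accumulates_below_absorbed\<close> every accumulation point of the new entry is an absorbed point or an
  accumulation point of the entry of one, so everything is inherited from smaller rows.
\<close>

lemma coherent_at_step: "coherent_at i \<alpha>"
  unfolding coherent_at_def club_in_iff
proof (intro conjI allI impI ballI)
  show sub: "C \<alpha> i \<subseteq> {..<\<alpha>}"
  proof -
    have "C \<xi> i \<subseteq> {..<\<alpha>}" if "\<xi> \<in> G \<alpha> i" for \<xi>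
      using coherent_atD(2)[OF absorbedD(6)[OF that]] absorbedD(3)[OF that] by fastforce
    then show ?thesis using ladderD(1)[OF ladder[OF \<alpha>]] matrix_unfold[of X c i \<alpha>] by blast
  qed
  show "\<exists>\<gamma>\<in>C \<alpha> i. \<beta> \<le> \<gamma>" if "\<beta> < \<alpha>" for \<beta>
    using ladderD(2)[OF ladder[OF \<alpha>] that] matrix_unfold[of X c i \<alpha>] less_imp_le by blast
  show "\<beta> \<in> C \<alpha> i" if "\<beta> < \<alpha>" "accumulates (C \<alpha> i) \<beta>" for \<beta>
  proof -
    from accumulates_below_absorbed[OF that] obtain \<xi> where \<xi>: "\<xi> \<in> G \<alpha> i" "\<beta> \<le> \<xi>" by blast
    note \<xi>D = absorbedD[OF \<xi>(1)]
    show ?thesis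
    proof (cases "\<beta> = \<xi>")
      case True
      then show ?thesis using \<xi>D(1) matrix_unfold[of X c i \<alpha>] by blast
    next
      case False
      then have "\<beta> < \<xi>" using \<xi>(2) by simp
      moreover have "accumulates (C \<xi> i) \<beta>"
        using accumulates_initial[OF \<xi>(2)] that(2) absorbed_initial[OF \<xi>(1)] by metis
      ultimately show ?thesis using club_closed[OF coherent_atD(1)[OF \<xi>D(6)]] \<xi>D(8) by blast
    qed
  qed
  have "c \<beta> \<le> i \<and> C \<beta> i = C \<alpha> i \<inter> {..<\<beta>}" if \<beta>: "\<beta> \<in> acc (C \<alpha> i)" for \<beta>
  proof -
    have "\<beta> < \<alpha>" "accumulates (C \<alpha> i) \<beta>" using \<beta> sub by (auto simp: acc_iff)
    then obtain \<xi> where \<xi>: "\<xi> \<in> G \<alpha> i" "\<beta> \<le> \<xi>" using accumulates_below_absorbed by blast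
    note \<xi>D = absorbedD[OF \<xi>(1)]
    show ?thesis
    proof (cases "\<beta> = \<xi>")
      case True
      then show ?thesis using \<xi>D(5) absorbed_initial[OF \<xi>(1)] by simp
    next
      case False
      then have "\<beta> < \<xi>" using \<xi>(2) by simp
      then have *: "\<beta> \<in> acc (C \<xi> i)"
        using \<beta> acc_initial[of "C \<alpha> i" \<xi>] absorbed_initial[OF \<xi>(1)] by auto
      then have "C \<beta> i = C \<alpha> i \<inter> {..<\<xi>} \<inter> {..<\<beta>}"
        using coherent_atD(5)[OF \<xi>D(6) *] absorbed_initial[OF \<xi>(1)] by simp
      also have "\<dots> = C \<alpha> i \<inter> {..<\<beta>}" using \<open>\<beta> < \<xi>\<close> by auto
      finally show ?thesis using coherent_atD(4)[OF \<xi>D(6) *] by blast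
    qed
  qed
  then show "\<And>\<beta>. \<beta> \<in> acc (C \<alpha> i) \<Longrightarrow> c \<beta> \<le> i"
    "\<And>\<beta>. \<beta> \<in> acc (C \<alpha> i) \<Longrightarrow> C \<beta> i = C \<alpha> i \<inter> {..<\<beta>}" by auto
  show "acc (D \<alpha>) \<subseteq> acc (C \<alpha> i)" using acc_absorbed absorbed_acc by blast
qed

end

lemma coherent_at: "\<alpha> \<in> acc {..<\<kappa>} \<Longrightarrow> c \<alpha> \<le> i \<Longrightarrow> coherent_at i \<alpha>"
proof (induction \<alpha> rule: less_induct)
  case (less \<alpha>)
  show ?case by (rule coherent_at_step[OF less.prems less.IH])
qed

text \<open>
  Choose a limit \<open>\<xi>\<close> of the ladder with \<open>\<beta> \<le> \<xi>\<close>. Absorbing \<open>\<xi>\<close> requires infinitely many accumulation points of its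
  entry, but once the largest element of \<open>acc (D \<alpha>)\<close> is among them the rest of \<open>acc (D \<alpha>)\<close> follows by
  coherence. So only the finite set \<open>R\<close> has to be taken care of, and the induction hypothesis
  for \<open>\<xi>\<close> provides a column for each of its members; the largest of these columns works.
\<close>

lemma matrix_covers:
  assumes c: "\<And>\<alpha>. \<alpha> \<in> acc {..<\<kappa>} \<Longrightarrow> c \<alpha> < \<mu>"
  shows "\<alpha> \<in> acc {..<\<kappa>} \<Longrightarrow> \<beta> \<in> acc {..<\<alpha>} \<Longrightarrow> \<exists>i. c \<alpha> \<le> i \<and> i < \<mu> \<and> \<beta> \<in> acc (C \<alpha> i)"
proof (induction \<alpha> arbitrary: \<beta> rule: less_induct)
  case (less \<alpha>)
  note \<alpha> = less.prems(1) and \<beta> = less.prems(2)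
  note lad = ladderD[OF ladder[OF \<alpha>]]
  obtain \<xi> where \<xi>: "\<xi> \<in> X \<alpha>" "\<xi> \<in> acc {..<\<alpha>}" "\<beta> \<le> \<xi>" using lad(6)[OF \<beta>] by blast
  have \<xi>\<kappa>: "\<xi> < \<alpha>" "\<xi> \<in> acc {..<\<kappa>}" using limitsD(1)[OF \<xi>(2)] limit_below[OF \<alpha> \<xi>(2)] by auto
  have below: "\<eta> \<in> acc {..<\<xi>}" if "\<eta> \<in> acc {..<\<alpha>}" "\<eta> < \<xi>" for \<eta>
    using limits_initial[of \<xi> \<alpha>] \<xi>\<kappa>(1) that by auto
  \<comment> \<open>at most the largest element of \<open>acc (D \<alpha>)\<close>, which need not exist\<close>
  define M where "M = {m \<in> acc (D \<alpha>). \<forall>\<eta>\<in>acc (D \<alpha>). \<eta> \<le> m}"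
  have "M \<subseteq> {m}" if "m \<in> M" for m using that unfolding M_def by (auto intro: antisym)
  then have "finite M" by (metis finite.emptyI finite_insert finite_subset all_not_in_conv)
  define R where "R = {\<eta> \<in> X \<alpha>. \<eta> < \<xi> \<and> \<eta> \<notin> acc (D \<alpha>)} \<union> {\<eta> \<in> insert \<beta> M. \<eta> < \<xi>}"
  have "finite R" using lad(7)[OF \<xi>\<kappa>(1)] \<open>finite M\<close> unfolding R_def by simp
  have "R \<subseteq> acc {..<\<xi>}"
  proof
    fix \<eta> assume "\<eta> \<in> R"
    then have "\<eta> < \<xi>" "\<eta> \<in> X \<alpha> \<or> \<eta> = \<beta>" using lad(3) unfolding R_def M_def by auto
    then show "\<eta> \<in> acc {..<\<xi>}" using below lad(5)[OF \<xi>(1,2)] \<beta> by blast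
  qed
  obtain i where i: "max (c \<alpha>) (c \<xi>) \<le> i" "i < \<mu>" "\<forall>\<eta>\<in>R. \<eta> \<in> acc (C \<xi> i)"
  proof -
    have "\<exists>i. i < \<mu> \<and> \<eta> \<in> acc (C \<xi> i)" if "\<eta> \<in> R" for \<eta>
      using less.IH[OF \<xi>\<kappa>] \<open>R \<subseteq> acc {..<\<xi>}\<close> that by blast
    moreover have "max (c \<alpha>) (c \<xi>) < \<mu>" using c \<alpha> \<xi>\<kappa>(2) by simp
    moreover have "\<eta> \<in> acc (C \<xi> j)" if "\<eta> \<in> acc (C \<xi> i)" "i \<le> j" for \<eta> i j
      using acc_mono[OF matrix_mono[OF that(2)]] that(1) by blast
    ultimately have "\<exists>i. max (c \<alpha>) (c \<xi>) \<le> i \<and> i < \<mu> \<and> (\<forall>\<eta>\<in>R. \<eta> \<in> acc (C \<xi> i))"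
      using finite_common_index[OF \<open>finite R\<close>, of \<mu> "\<lambda>\<eta> i. \<eta> \<in> acc (C \<xi> i)"] by blast
    then show thesis using that by blast
  qed
  then have le: "c \<alpha> \<le> i" "c \<xi> \<le> i" by auto
  have coh: "coherent_at i \<eta>" if "\<eta> \<in> acc {..<\<kappa>}" "c \<eta> \<le> i" for \<eta> using that by (rule coherent_at)
  have "X \<alpha> \<inter> {..<\<xi>} \<subseteq> acc (C \<xi> i)" if "\<xi> \<notin> acc (D \<alpha>)"
  proof
    fix \<eta> assume \<eta>: "\<eta> \<in> X \<alpha> \<inter> {..<\<xi>}"
    show "\<eta> \<in> acc (C \<xi> i)"
    proof (cases "\<eta> \<in> acc (D \<alpha>)")
      case True
      have below_\<xi>: "\<zeta> < \<xi>" if "\<zeta> \<in> acc (D \<alpha>)" for \<zeta>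
        using lad(4)[OF that \<xi>(1)] that \<open>\<xi> \<notin> acc (D \<alpha>)\<close> by (metis not_less_iff_gr_or_eq)
      have closed: "\<zeta> \<in> acc (D \<alpha>)" if "\<zeta> < \<alpha>" "accumulates (acc (D \<alpha>)) \<zeta>" for \<zeta>
      proof -
        have "accumulates (D \<alpha>) \<zeta>" using that(2) by (rule accumulates_mono) (auto simp: acc_iff)
        then show ?thesis
          using club_closed[OF coherent_club[OF coherent \<alpha>] that(1)] by (simp add: acc_iff)
      qed
      have "acc (D \<alpha>) \<noteq> {}" "\<forall>\<zeta>\<in>acc (D \<alpha>). \<zeta> \<le> \<xi>"
        using True below_\<xi> less_imp_le by blast+
      from closed_has_greatest[OF this \<xi>\<kappa>(1) closed] obtain m where m: "m \<in> M" "m < \<xi>"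
        using below_\<xi> unfolding M_def by blast
      then have m\<xi>: "m \<in> acc (C \<xi> i)" using i(3) unfolding R_def by blast
      have mD: "m \<in> acc (D \<alpha>)" "\<eta> \<le> m" using m(1) True unfolding M_def by auto
      show ?thesis
      proof (cases "\<eta> = m")
        case False
        then have "\<eta> \<in> acc (D m)" using coherent_acc(4)[OF coherent \<alpha> mD(1)] True mD(2) by auto
        moreover have "coherent_at i m"
          using coherent_acc(2)[OF coherent \<alpha> mD(1)] colour[OF \<alpha> mD(1)] le(1) by (intro coh) auto
        ultimately have "\<eta> \<in> acc (C m i)" using coherent_atD(3) by blast
        also have "C m i \<subseteq> C \<xi> i" using coherent_atD(5)[OF coh[OF \<xi>\<kappa>(2) le(2)] m\<xi>] by blast
        then have "acc (C m i) \<subseteq> acc (C \<xi> i)" by (rule acc_mono)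
        finally show ?thesis .
      qed (use m\<xi> in simp)
    qed (use i(3) \<eta> in \<open>auto simp: R_def\<close>)
  qed
  then have "\<xi> \<in> G \<alpha> i"
    using acc_absorbed[OF \<alpha> le(1) coh] \<xi>(1,2) le(2) unfolding absorbed_def by blast
  note absorbed = absorbed_acc[OF \<alpha> le(1) coh this] absorbedD(8)[OF \<alpha> le(1) coh this]
  have "\<beta> \<in> acc (C \<alpha> i)"
  proof (cases "\<beta> = \<xi>")
    case False
    then have "\<beta> < \<xi>" using \<xi>(3) by (simp only: less_le simp_thms)
    then have "\<beta> \<in> R" unfolding R_def by simp
    then show ?thesis using i(3) acc_mono[OF absorbed(2)] by blast
  qed (use absorbed(1) in simp)
  then show ?case using le(1) i(2) by blast
qed

end

section \<open>Absence of threads and the theorem\<close>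

text \<open>
  By regularity a thread agrees cofinally often with the entries of a single column \<open>i\<close>. Its accumulation
  points therefore have index at most \<open>i\<close>, although the ordinals of any larger index form a stationary set.
\<close>

lemma (in uncountable_regular) no_matrix_thread:
  fixes \<iota> :: "'o \<Rightarrow> 'o"
  assumes "\<mu> < \<kappa>" and no_largest: "\<And>i. i < \<mu> \<Longrightarrow> \<exists>j>i. j < \<mu>"
    and coh: "\<And>\<alpha> \<beta> i. \<beta> \<in> acc {..<\<kappa>} \<Longrightarrow> \<iota> \<beta> \<le> i \<Longrightarrow> i < \<mu> \<Longrightarrow> \<alpha> \<in> acc (C \<beta> i) \<Longrightarrow> \<iota> \<alpha> \<le> i"
    and stat: "\<And>i. i < \<mu> \<Longrightarrow> stationary_in \<kappa> {\<alpha> \<in> acc {..<\<kappa>}. \<iota> \<alpha> = i}"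
    and E: "club_in \<kappa> E"
  shows "\<exists>\<alpha>\<in>acc E. \<forall>i. \<iota> \<alpha> \<le> i \<and> i < \<mu> \<longrightarrow> C \<alpha> i \<noteq> E \<inter> {..<\<alpha>}"
proof (rule ccontr)
  assume "\<not> ?thesis"
  then have thread: "\<exists>i. \<iota> \<alpha> \<le> i \<and> i < \<mu> \<and> C \<alpha> i = E \<inter> {..<\<alpha>}" if "\<alpha> \<in> acc E" for \<alpha>
    using that by blast
  define A where "A i = {\<alpha> \<in> acc E. \<iota> \<alpha> \<le> i \<and> C \<alpha> i = E \<inter> {..<\<alpha>}}" for i
  have acc\<kappa>: "\<alpha> \<in> acc {..<\<kappa>}" if "\<alpha> \<in> acc E" for \<alpha> using acc_mono[OF club_subset[OF E]] that by blast
  have "\<exists>i<\<mu>. \<forall>\<gamma><\<kappa>. \<exists>\<alpha>\<in>A i. \<gamma> < \<alpha>"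
  proof (rule ccontr)
    assume "\<not> ?thesis"
    then have "\<forall>i. \<exists>\<gamma>. i < \<mu> \<longrightarrow> \<gamma> < \<kappa> \<and> (\<forall>\<alpha>\<in>A i. \<not> \<gamma> < \<alpha>)" by simp
    from choice[OF this] obtain g
      where g: "\<And>i. i < \<mu> \<Longrightarrow> g i < \<kappa>" "\<And>i \<alpha>. i < \<mu> \<Longrightarrow> \<alpha> \<in> A i \<Longrightarrow> \<not> g i < \<alpha>" by blast
    obtain \<gamma> where \<gamma>: "\<gamma> < \<kappa>" "\<forall>i<\<mu>. g i < \<gamma>" using image_bounded[OF \<open>\<mu> < \<kappa>\<close>, of g] g(1) by blast
    obtain \<alpha> where \<alpha>: "\<alpha> \<in> acc E" "\<gamma> < \<alpha>" using club_above[OF club_acc[OF E] \<gamma>(1)] by blast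
    obtain i where "i < \<mu>" "\<alpha> \<in> A i" using thread[OF \<alpha>(1)] \<alpha>(1) unfolding A_def by blast
    then have "\<not> g i < \<alpha>" "g i < \<gamma>" using g(2) \<gamma>(2) by blast+
    then show False using \<alpha>(2) less_trans by blast
  qed
  then obtain i where i: "i < \<mu>" "\<forall>\<gamma><\<kappa>. \<exists>\<alpha>\<in>A i. \<gamma> < \<alpha>" by blast
  obtain j where j: "i < j" "j < \<mu>" using no_largest[OF i(1)] by blast
  have "{\<alpha> \<in> acc {..<\<kappa>}. \<iota> \<alpha> = j} \<inter> acc E \<noteq> {}"
    using stat[OF j(2)] club_acc[OF E] unfolding stationary_in_def by blast
  then obtain \<alpha> where \<alpha>: "\<alpha> \<in> acc E" "\<iota> \<alpha> = j" by blast
  then obtain \<beta> where \<beta>: "\<beta> \<in> A i" "\<alpha> < \<beta>" using i(2) limitsD(1)[OF acc\<kappa>] by blast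
  have "\<alpha> \<in> acc (E \<inter> {..<\<beta>})" using \<alpha>(1) \<beta>(2) acc_initial[of E \<beta>] by simp
  then have "\<alpha> \<in> acc (C \<beta> i)" using \<beta>(1) unfolding A_def by simp
  then have "\<iota> \<alpha> \<le> i" using coh[of \<beta> i \<alpha>] i(1) \<beta>(1) acc\<kappa> unfolding A_def by blast
  then show False using \<alpha>(2) j(1) by simp
qed

theorem theorem3p4:
  fixes \<kappa> \<mu> :: "'o::wellorder" and S :: "'o set"
  assumes "infinite_regular_cardinal \<mu>"
    and "infinite_regular_cardinal \<kappa>"
    and "\<mu> < \<kappa>"
    and "square \<kappa>"
    and "stationary_in \<kappa> S"
  shows "\<exists>\<iota> C. square_ind_seq \<kappa> \<mu> \<iota> C \<and>
    (\<forall>i<\<mu>. stationary_in \<kappa> {\<alpha> \<in> S \<inter> acc {..<\<kappa>}. \<iota> \<alpha> = i}) \<and>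
    (\<exists>D. square_seq \<kappa> D \<and> (\<forall>\<alpha>\<in>acc {..<\<kappa>}. acc (D \<alpha>) \<subseteq> acc (C \<alpha> (\<iota> \<alpha>))))"
proof -
  interpret uncountable_regular \<kappa> using uncountable_regularI[OF assms(1-3)] .
  have "{..<\<mu>} \<noteq> {}" using infinite_lessThan[OF assms(1)] by auto
  then have "ord_zero < \<mu>" using ord_zero_le le_less_trans by blast
  from coherent_colouring_exists[OF assms(2) uncountable_regular_axioms assms(3) this assms(4,5)]
  obtain D c where sq: "square_seq \<kappa> D" and c: "\<And>\<alpha>. c \<alpha> < \<mu>"
    and colour: "\<And>\<alpha> \<beta>. \<alpha> \<in> acc {..<\<kappa>} \<Longrightarrow> \<beta> \<in> acc (D \<alpha>) \<Longrightarrow> c \<beta> = c \<alpha>"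
    and stat: "\<And>i. i < \<mu> \<Longrightarrow> stationary_in \<kappa> {\<alpha> \<in> S \<inter> acc {..<\<kappa>}. c \<alpha> = i}"
    by blast
  have coh: "coherent_on \<kappa> D" using sq by (simp add: square_seq_iff)
  have "\<forall>\<alpha>. \<exists>X. \<alpha> \<in> acc {..<\<kappa>} \<longrightarrow> ladder \<alpha> (acc (D \<alpha>)) X"
    using ladder_exists coherent_club[OF coh] by blast
  from choice[OF this] obtain X where X: "\<And>\<alpha>. \<alpha> \<in> acc {..<\<kappa>} \<Longrightarrow> ladder \<alpha> (acc (D \<alpha>)) (X \<alpha>)"
    by blast
  interpret coloured_ladders \<kappa> D X c
    by unfold_locales (fact coh X colour)+
  note at = coherent_atD[OF coherent_at]
  define M where "M \<alpha> i = matrix X c i \<alpha>" for \<alpha> i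
  have "square_ind_seq \<kappa> \<mu> c M"
    unfolding square_ind_seq_def M_def
  proof (intro conjI ballI allI impI)
    show "c \<alpha> < \<mu>" for \<alpha> by (rule c)
    show "club_in \<alpha> (matrix X c i \<alpha>)" if "\<alpha> \<in> acc {..<\<kappa>}" "c \<alpha> \<le> i \<and> i < \<mu>" for \<alpha> i
      using at(1) that by blast
    show "matrix X c i \<alpha> \<subseteq> matrix X c j \<alpha>" if "c \<alpha> \<le> i \<and> i < j \<and> j < \<mu>" for \<alpha> i j
      using that less_imp_le by (intro matrix_mono) blast
    show "c \<alpha> \<le> i" if "\<beta> \<in> acc {..<\<kappa>}" "c \<beta> \<le> i \<and> i < \<mu>" "\<alpha> \<in> acc (matrix X c i \<beta>)" for \<alpha> \<beta> i
      using at(4) that by blast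
    show "matrix X c i \<alpha> = matrix X c i \<beta> \<inter> {..<\<alpha>}"
      if "\<beta> \<in> acc {..<\<kappa>}" "c \<beta> \<le> i \<and> i < \<mu>" "\<alpha> \<in> acc (matrix X c i \<beta>)" for \<alpha> \<beta> i
      using at(5) that by blast
    show "\<exists>i. c \<beta> \<le> i \<and> i < \<mu> \<and> \<alpha> \<in> acc (matrix X c i \<beta>)"
      if "\<alpha> \<in> acc {..<\<kappa>}" "\<beta> \<in> acc {..<\<kappa>}" "\<alpha> < \<beta>" for \<alpha> \<beta>
    proof (rule matrix_covers[OF c that(2)])
      show "\<alpha> \<in> acc {..<\<beta>}"
        using limits_initial[of \<beta> \<kappa>] limitsD(1)[OF that(2)] that(1,3) by simp
    qed
    have "stationary_in \<kappa> {\<alpha> \<in> acc {..<\<kappa>}. c \<alpha> = i}" if "i < \<mu>" for i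
    proof (rule stationary_mono[OF stat[OF that]])
      show "{\<alpha> \<in> acc {..<\<kappa>}. c \<alpha> = i} \<subseteq> {..<\<kappa>}" using limitsD(1) by blast
    qed blast
    note thread = no_matrix_thread[where C = "\<lambda>\<alpha> i. matrix X c i \<alpha>" and \<iota> = c,
        OF assms(3) no_largest[OF assms(1)] _ this]
    have no_thread: "\<exists>\<alpha>\<in>acc E. \<forall>i. c \<alpha> \<le> i \<and> i < \<mu> \<longrightarrow> matrix X c i \<alpha> \<noteq> E \<inter> {..<\<alpha>}"
      if "club_in \<kappa> E" for E
    proof (rule thread)
      show "c \<alpha> \<le> i" if "\<beta> \<in> acc {..<\<kappa>}" "c \<beta> \<le> i" "\<alpha> \<in> acc (matrix X c i \<beta>)" for \<alpha> \<beta> i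
        using that by (rule at(4))
    qed (assumption | fact that)+
    show "\<not> (\<exists>E. club_in \<kappa> E \<and>
        (\<forall>\<alpha>\<in>acc E. \<exists>i. c \<alpha> \<le> i \<and> i < \<mu> \<and> matrix X c i \<alpha> = E \<inter> {..<\<alpha>}))"
    proof (intro notI, elim exE conjE)
      fix E assume E: "club_in \<kappa> E"
        and *: "\<forall>\<alpha>\<in>acc E. \<exists>i. c \<alpha> \<le> i \<and> i < \<mu> \<and> matrix X c i \<alpha> = E \<inter> {..<\<alpha>}"
      from no_thread[OF E] obtain \<alpha> where "\<alpha> \<in> acc E"
        and "\<forall>i. c \<alpha> \<le> i \<and> i < \<mu> \<longrightarrow> matrix X c i \<alpha> \<noteq> E \<inter> {..<\<alpha>}" by (elim bexE)
      with * show False by fast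
    qed
  qed
  moreover have "acc (D \<alpha>) \<subseteq> acc (M \<alpha> (c \<alpha>))" if "\<alpha> \<in> acc {..<\<kappa>}" for \<alpha>
    unfolding M_def using at(3)[OF that order_refl] .
  ultimately show ?thesis using stat sq by blast
qed

end
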